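(* Let $\mathcal{H}_A,\mathcal{H}_B$ be finite-dimensional complex Hilbert spaces, $d_A=\dim\mathcal{H}_A\ge 1$, $\dim\mathcal{H}_B\ge 1$, and fix an orthonormal basis $\{|j\rangle\}$ of $\mathcal{H}_A$. The following two constructions (spelled out in the context) are mutually inverse, and hence define a bijection $(\rho_A,\mathcal{E}^r_{B|A})\leftrightarrow\tau_{AB}$ between the set of pairs consisting of a density operator $\rho_A$ on $\mathcal{H}_A$ and a trace-preserving completely positive map $\mathcal{E}^r_{B|A}:\mathfrak{L}(\operatorname{supp}\rho_A)\to\mathfrak{L}(\mathcal{H}_B)$, and the set of density operators $\tau_{AB}$ on $\mathcal{H}_A\otimes\mathcal{H}_B$. Forward: $(\rho_A,\mathcal{E}^r_{B|A})\mapsto \tau_{AB}=(\mathcal{I}_A\otimes\mathcal{E}^r_{B|A'})\left(|\Phi\rangle\langle\Phi|_{AA'}\right)$, where $|\Phi\rangle_{AA'}=\sqrt{d_A}\,\left((\rho_A^T)^{1/2}\otimes I_{A'}\right)|\Phi^+\rangle_{AA'}$. Reverse: $\tau_{AB}\mapsto(\rho_A,\mathcal{E}^r_{B|A})$, where $\rho_A=\tau_A^T$ with $\tau_A=\mathrm{Tr}_B(\tau_{AB})$, and $\mathcal{E}^r_{B|A}$ is the unique trace-preserving completely positive map $\mathfrak{L}(\operatorname{supp}\rho_A)\to\mathfrak{L}(\mathcal{H}_B)$ satisfying $(\mathcal{I}_A\otimes\mathcal{E}^r_{B|A'})\left(|\Phi^{+}\rangle^r\langle\Phi^{+}|^r_{AA'}\right)=\sigma_{AB}$,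 with $\sigma_{AB}=\frac{1}{d_A^r}\,(\tau_A^{-1/2}\otimes I_B)\,\tau_{AB}\,(\tau_A^{-1/2}\otimes I_B)$.
   Context: $\mathfrak{L}(\mathcal{H})$ is the space of linear operators on $\mathcal{H}$; a density operator is a positive semidefinite operator of trace 1. The support $\operatorname{supp}\rho$ of a positive semidefinite operator $\rho$ is the orthogonal complement of its kernel, regarded as a Hilbert space. A linear map $\mathfrak{L}(\operatorname{supp}\rho_A)\to\mathfrak{L}(\mathcal{H}_B)$ which is completely positive and trace preserving is the same thing as the restriction of a trace-preserving completely positive map $\mathfrak{L}(\mathcal{H}_A)\to\mathfrak{L}(\mathcal{H}_B)$ to operators supported on $\operatorname{supp}\rho_A$; the superscript $r$ indicates this restriction. $A'$ is a second system with $\mathcal{H}_{A'}=\mathcal{H}_A$ (same basis), $|\Phi^+\rangle_{AA'}=\frac{1}{\sqrt{d_A}}\sum_{j=1}^{d_A}|j\rangle_A\otimes|j\rangle_{A'}$, $^T$ denotes the transpose with respect to the fixed basis $\{|j\rangle\}$, $\mathcal{I}_A$ is the identity map on $\mathfrak{L}(\mathcal{H}_A)$, and $\mathcal{E}^r_{B|A'}$ denotes the map $\mathcal{E}^r_{B|A}$ applied to the system $A'$. (The vector $|\Phi\rangle_{AA'}$ lies in $\mathcal{H}_A\otimes\operatorname{supp}\rho_{A'}$, so applying $\mathcal{E}^r_{B|A'}$ on $A'$ makes sense.) $\tau_A^{-1}$ denotes the inverse of $\tau_A$ on $\operatorname{supp}\tau_A$, extended by $0$ on $\ker\tau_A$,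 and $\tau_A^{-1/2}$ its positive square root. $d_A^r$ is the rank of $\tau_A$, $P_A$ is the orthogonal projector onto $\operatorname{supp}\tau_A$, and $|\Phi^+\rangle^r_{AA'}=\sqrt{d_A/d_A^r}\,(P_A\otimes I_{A'})|\Phi^+\rangle_{AA'}$, which is a unit vector in $\operatorname{supp}\tau_A\otimes\operatorname{supp}\rho_{A'}$, where $\rho_{A'}=\tau_A^T$ is regarded as an operator on $\mathcal{H}_{A'}$. *)

theory Defs
  imports "HOL-Analysis.Analysis"
begin

text \<open>
  A Hilbert space with orthonormal basis indexed by a finite type \<open>'n\<close> is \<open>complex ^ 'n\<close>, the
  basis vector \<open>|j\<rangle>\<close> being \<open>axis j 1\<close>; operators are square matrices. The tensor product of
  \<open>complex ^ 'm\<close> and \<open>complex ^ 'n\<close> is \<open>complex ^ ('m \<times> 'n)\<close>.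
\<close>

definition cinner :: "complex ^ 'n \<Rightarrow> complex ^ 'n \<Rightarrow> complex" where
  "cinner u v = (\<Sum>i\<in>UNIV. cnj (u $ i) * v $ i)"

definition ketbra :: "complex ^ 'm \<Rightarrow> complex ^ 'n \<Rightarrow> complex ^ 'n ^ 'm" where
  "ketbra u v = (\<chi> i j. u $ i * cnj (v $ j))"

definition tensor_vec :: "complex ^ 'm \<Rightarrow> complex ^ 'n \<Rightarrow> complex ^ ('m \<times> 'n)" where
  "tensor_vec u v = (\<chi> p. u $ fst p * v $ snd p)"

definition tensor_mat ::
  "complex ^ 'm ^ 'm \<Rightarrow> complex ^ 'n ^ 'n \<Rightarrow> complex ^ ('m \<times> 'n) ^ ('m \<times> 'n)" where
  "tensor_mat M N = (\<chi> p q. M $ fst p $ fst q * N $ snd p $ snd q)"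

definition scale_mat :: "complex \<Rightarrow> complex ^ 'n ^ 'm \<Rightarrow> complex ^ 'n ^ 'm" where
  "scale_mat c M = (\<chi> i j. c * M $ i $ j)"

definition psd :: "complex ^ 'n ^ 'n \<Rightarrow> bool" where
  "psd M \<longleftrightarrow> (\<forall>v. cinner v (M *v v) \<in> \<real>\<^sub>\<ge>\<^sub>0)"

definition density_ops :: "(complex ^ 'n ^ 'n) set" where
  "density_ops = {M. psd M \<and> trace M = 1}"

definition psd_sqrt :: "complex ^ 'n ^ 'n \<Rightarrow> complex ^ 'n ^ 'n" where
  "psd_sqrt M = (THE S. psd S \<and> S ** S = M)"

definition ker :: "complex ^ 'n ^ 'n \<Rightarrow> (complex ^ 'n) set" where
  "ker M = {v. M *v v = 0}"

definition ortho_compl :: "(complex ^ 'n) set \<Rightarrow> (complex ^ 'n) set" where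
  "ortho_compl S = {v. \<forall>u\<in>S. cinner u v = 0}"

definition supp :: "complex ^ 'n ^ 'n \<Rightarrow> (complex ^ 'n) set" where
  "supp M = ortho_compl (ker M)"

definition ortho_projector :: "(complex ^ 'n) set \<Rightarrow> complex ^ 'n ^ 'n" where
  "ortho_projector S = (THE P. (\<forall>v\<in>S. P *v v = v) \<and> (\<forall>v\<in>ortho_compl S. P *v v = 0))"

text \<open>For positive semidefinite \<open>M\<close>: the inverse of \<open>M\<close> on \<open>supp M\<close>, extended by \<open>0\<close> on \<open>ker M\<close>.\<close>

definition supp_inverse :: "complex ^ 'n ^ 'n \<Rightarrow> complex ^ 'n ^ 'n" where
  "supp_inverse M = (THE X. (\<forall>v\<in>supp M. X *v (M *v v) = v) \<and> (\<forall>v\<in>ker M. X *v v = 0))"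

text \<open>
  For a subspace \<open>S\<close>, an operator on the Hilbert space \<open>S\<close> is identified with its extension by \<open>0\<close>
  on the orthogonal complement of \<open>S\<close>. This preserves and reflects positivity and preserves the
  trace.
\<close>

definition ops_on :: "(complex ^ 'n) set \<Rightarrow> (complex ^ 'n ^ 'n) set" where
  "ops_on S = {X. (\<forall>v. X *v v \<in> S) \<and> (\<forall>v\<in>ortho_compl S. X *v v = 0)}"

text \<open>
  An operator on \<open>\<complex>\<^sup>n \<otimes> H\<close> is an \<open>n \<times> n\<close> array of operators on \<open>H\<close>, and a vector in \<open>\<complex>\<^sup>n \<otimes> H\<close> is an
  \<open>n\<close>-tuple of vectors in \<open>H\<close>. The map \<open>\<I>\<^sub>n \<otimes> E\<close> then acts by applying \<open>E\<close> to every entry.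
\<close>

definition block_psd :: "nat \<Rightarrow> (nat \<Rightarrow> nat \<Rightarrow> complex ^ 'n ^ 'n) \<Rightarrow> bool" where
  "block_psd n X \<longleftrightarrow> (\<forall>v. (\<Sum>i<n. \<Sum>j<n. cinner (v i) (X i j *v v j)) \<in> \<real>\<^sub>\<ge>\<^sub>0)"

definition completely_positive_on ::
  "(complex ^ 'm) set \<Rightarrow> (complex ^ 'm ^ 'm \<Rightarrow> complex ^ 'n ^ 'n) \<Rightarrow> bool" where
  "completely_positive_on S E \<longleftrightarrow>
     (\<forall>n X. (\<forall>i<n. \<forall>j<n. X i j \<in> ops_on S) \<longrightarrow> block_psd n X \<longrightarrow> block_psd n (\<lambda>i j. E (X i j)))"

definition trace_preserving_on ::
  "(complex ^ 'm) set \<Rightarrow> (complex ^ 'm ^ 'm \<Rightarrow> complex ^ 'n ^ 'n) \<Rightarrow> bool" where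
  "trace_preserving_on S E \<longleftrightarrow> (\<forall>X\<in>ops_on S. trace (E X) = trace X)"

definition clinear_on_ops ::
  "(complex ^ 'm) set \<Rightarrow> (complex ^ 'm ^ 'm \<Rightarrow> complex ^ 'n ^ 'n) \<Rightarrow> bool" where
  "clinear_on_ops S E \<longleftrightarrow>
     (\<forall>X\<in>ops_on S. \<forall>Y\<in>ops_on S. E (X + Y) = E X + E Y) \<and>
     (\<forall>c. \<forall>X\<in>ops_on S. E (scale_mat c X) = scale_mat c (E X))"

text \<open>
  The trace-preserving completely positive maps from the operators on \<open>S\<close> to the operators on
  \<open>complex ^ 'n\<close>. They are \<open>undefined\<close> outside their domain, so that equality of HOL functions is
  equality of maps.
\<close>

definition tpcp_maps ::
  "(complex ^ 'm) set \<Rightarrow> (complex ^ 'm ^ 'm \<Rightarrow> complex ^ 'n ^ 'n) set" where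
  "tpcp_maps S =
     {E \<in> extensional (ops_on S).
        clinear_on_ops S E \<and> completely_positive_on S E \<and> trace_preserving_on S E}"

text \<open>
  \<open>\<I> \<otimes> E\<close>, with \<open>E\<close> acting on the second tensor factor: writing \<open>X\<close> as the sum of the
  \<open>|j\<rangle>\<langle>k| \<otimes> block X j k\<close>, the result is the sum of the \<open>|j\<rangle>\<langle>k| \<otimes> E (block X j k)\<close>.
\<close>

definition block ::
  "complex ^ ('k::finite \<times> 'm) ^ ('k \<times> 'm) \<Rightarrow> 'k \<Rightarrow> 'k \<Rightarrow> complex ^ 'm ^ 'm" where
  "block X j k = (\<chi> a a'. X $ (j, a) $ (k, a'))"

definition id_tensor ::
  "(complex ^ 'm ^ 'm \<Rightarrow> complex ^ 'n ^ 'n) \<Rightarrow>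
   complex ^ ('k::finite \<times> 'm) ^ ('k \<times> 'm) \<Rightarrow> complex ^ ('k \<times> 'n) ^ ('k \<times> 'n)" where
  "id_tensor E X = (\<chi> p q. E (block X (fst p) (fst q)) $ snd p $ snd q)"

lemma id_tensor_tensor_mat:
  assumes "clinear_on_ops S E" and "N \<in> ops_on S"
  shows "id_tensor E (tensor_mat M N) = tensor_mat M (E N)"
proof -
  have "block (tensor_mat M N) j k = scale_mat (M $ j $ k) N" for j k
    by (simp add: block_def tensor_mat_def scale_mat_def vec_eq_iff)
  moreover have "E (scale_mat c N) = scale_mat c (E N)" for c
    using assms by (simp add: clinear_on_ops_def)
  ultimately have "id_tensor E (tensor_mat M N) =
      (\<chi> p q. scale_mat (M $ fst p $ fst q) (E N) $ snd p $ snd q)"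
    by (simp add: id_tensor_def)
  then show ?thesis
    by (simp add: scale_mat_def tensor_mat_def)
qed

definition partial_trace_B ::
  "complex ^ ('a \<times> 'b::finite) ^ ('a \<times> 'b) \<Rightarrow> complex ^ 'a ^ 'a" where
  "partial_trace_B \<tau> = (\<chi> i k. \<Sum>b\<in>UNIV. \<tau> $ (i, b) $ (k, b))"

definition Phi_plus :: "complex ^ ('a::finite \<times> 'a)" where
  "Phi_plus =
     complex_of_real (1 / sqrt (real CARD('a))) *s (\<Sum>j\<in>UNIV. tensor_vec (axis j 1) (axis j 1))"

definition Phi :: "complex ^ 'a ^ 'a \<Rightarrow> complex ^ ('a \<times> 'a)" where
  "Phi \<rho> = complex_of_real (sqrt (real CARD('a))) *s
     (tensor_mat (psd_sqrt (transpose \<rho>)) (mat 1) *v Phi_plus)"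

definition forward ::
  "(complex ^ 'a ^ 'a) \<times> (complex ^ 'a ^ 'a \<Rightarrow> complex ^ 'b ^ 'b) \<Rightarrow>
   complex ^ ('a \<times> 'b) ^ ('a \<times> 'b)" where
  "forward = (\<lambda>(\<rho>, E). id_tensor E (ketbra (Phi \<rho>) (Phi \<rho>)))"

definition Phi_plus_r :: "complex ^ 'a ^ 'a \<Rightarrow> complex ^ ('a \<times> 'a)" where
  "Phi_plus_r \<tau>A = complex_of_real (sqrt (real CARD('a) / real (rank \<tau>A))) *s
     (tensor_mat (ortho_projector (supp \<tau>A)) (mat 1) *v Phi_plus)"

definition sigma ::
  "complex ^ ('a::finite \<times> 'b::finite) ^ ('a \<times> 'b) \<Rightarrow> complex ^ ('a \<times> 'b) ^ ('a \<times> 'b)" where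
  "sigma \<tau> =
     (let \<tau>A = partial_trace_B \<tau>;
          R = tensor_mat (psd_sqrt (supp_inverse \<tau>A)) (mat 1)
      in scale_mat (1 / of_nat (rank \<tau>A)) (R ** \<tau> ** R))"

definition reverse_rho :: "complex ^ ('a \<times> 'b::finite) ^ ('a \<times> 'b) \<Rightarrow> complex ^ 'a ^ 'a" where
  "reverse_rho \<tau> = transpose (partial_trace_B \<tau>)"

definition reverse_condition ::
  "complex ^ ('a \<times> 'b) ^ ('a \<times> 'b) \<Rightarrow> (complex ^ 'a ^ 'a \<Rightarrow> complex ^ 'b ^ 'b) \<Rightarrow> bool" where
  "reverse_condition \<tau> E \<longleftrightarrow>
     E \<in> tpcp_maps (supp (reverse_rho \<tau>)) \<and>
     id_tensor E
       (ketbra (Phi_plus_r (partial_trace_B \<tau>)) (Phi_plus_r (partial_trace_B \<tau>))) = sigma \<tau>"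

definition reverse ::
  "complex ^ ('a \<times> 'b) ^ ('a \<times> 'b) \<Rightarrow>
   (complex ^ 'a ^ 'a) \<times> (complex ^ 'a ^ 'a \<Rightarrow> complex ^ 'b ^ 'b)" where
  "reverse \<tau> = (reverse_rho \<tau>, THE E. reverse_condition \<tau> E)"

definition state_map_pairs ::
  "((complex ^ 'a ^ 'a) \<times> (complex ^ 'a ^ 'a \<Rightarrow> complex ^ 'b ^ 'b)) set" where
  "state_map_pairs = (SIGMA \<rho> : density_ops. tpcp_maps (supp \<rho>))"

end

theory Submission
  imports Defs
begin

text \<open>
  Write \<open>M = \<tau>\<^sub>A\<close>, and let \<open>s\<close>, \<open>w\<close>, \<open>P\<close> be the square root of \<open>M\<close>, the square root of the inverse
  of \<open>M\<close> on its support, and the support projector; then \<open>w s = s w = P\<close>. With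
  \<open>J\<^sub>\<tau>(X) = \<Sum>\<^sub>j\<^sub>k X\<^sub>j\<^sub>k \<tau>\<^sub>j\<^sub>k\<close>, where the \<open>\<tau>\<^sub>j\<^sub>k\<close> are the blocks of \<open>\<tau>\<close>, the reverse condition says
  that \<open>E\<close> agrees with \<open>X \<mapsto> J\<^sub>\<tau>(w\<^sup>T X w\<^sup>T)\<close> on operators on the support, and \<open>\<tau>\<close> is the forward
  image of \<open>(M\<^sup>T, E)\<close> iff \<open>E(s\<^sup>T X s\<^sup>T) = J\<^sub>\<tau>(X)\<close> for all \<open>X\<close>. These invert each other because
  \<open>w s = P\<close> and because a positive semidefinite \<open>\<tau>\<close> satisfies \<open>(P \<otimes> I) \<tau> (P \<otimes> I) = \<tau>\<close>.
\<close>

subsection \<open>Inner product and adjoint\<close>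

definition adj :: "complex ^ 'n ^ 'm \<Rightarrow> complex ^ 'm ^ 'n" where
  "adj M = (\<chi> i j. cnj (M $ j $ i))"

lemma adj_component [simp]: "adj M $ i $ j = cnj (M $ j $ i)"
  by (simp add: adj_def)

lemma adj_adj [simp]: "adj (adj M) = M"
  by (simp add: vec_eq_iff)

lemma adj_mult: "adj (A ** B) = adj B ** adj A"
  by (simp add: vec_eq_iff matrix_matrix_mult_def mult.commute)

lemma adj_transpose: "adj (transpose M) = transpose (adj M)"
  by (simp add: vec_eq_iff transpose_def)

lemma cinner_add_left: "cinner (u + v) w = cinner u w + cinner v w"
  by (simp add: cinner_def sum.distrib algebra_simps)

lemma cinner_add_right: "cinner w (u + v) = cinner w u + cinner w v"
  by (simp add: cinner_def sum.distrib algebra_simps)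

lemma cinner_diff_right: "cinner w (u - v) = cinner w u - cinner w v"
  by (simp add: cinner_def sum_subtractf algebra_simps)

lemma cinner_scale_left: "cinner (c *s u) w = cnj c * cinner u w"
  by (simp add: cinner_def sum_distrib_left algebra_simps)

lemma cinner_scale_right: "cinner w (c *s u) = c * cinner w u"
  by (simp add: cinner_def sum_distrib_left algebra_simps)

lemma cinner_zero [simp]: "cinner 0 w = 0" "cinner w 0 = 0"
  by (simp_all add: cinner_def)

lemma cinner_commute: "cinner u v = cnj (cinner v u)"
  by (simp add: cinner_def mult.commute)

lemma of_real_cmod_square: "(complex_of_real (cmod z))\<^sup>2 = z * cnj z"
  using complex_norm_square[of z] by simp

lemma cinner_self: "cinner v v = of_real ((norm v)\<^sup>2)"
  by (simp add: cinner_def norm_vec_def L2_set_def sum_nonneg of_real_cmod_square mult.commute)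

lemma cinner_self_eq_0 [simp]: "cinner v v = 0 \<longleftrightarrow> v = 0"
  by (simp add: cinner_self)

lemma cinner_adj: "cinner u (M *v v) = cinner (adj M *v u) v"
proof -
  have "cinner u (M *v v) = (\<Sum>i\<in>UNIV. \<Sum>j\<in>UNIV. cnj (u $ i) * M $ i $ j * v $ j)"
    by (simp add: cinner_def matrix_vector_mult_def sum_distrib_left mult.assoc)
  also have "\<dots> = (\<Sum>j\<in>UNIV. \<Sum>i\<in>UNIV. cnj (u $ i) * M $ i $ j * v $ j)"
    by (rule sum.swap)
  also have "\<dots> = cinner (adj M *v u) v"
    by (simp add: cinner_def matrix_vector_mult_def sum_distrib_left sum_distrib_right mult_ac)
  finally show ?thesis .
qed

lemma matrix_vector_mult_axis: "(M *v axis j 1) $ i = (M $ i $ j :: complex)"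
  by (simp add: matrix_vector_mult_def axis_def if_distrib cong: if_cong)

lemma cinner_axis: "cinner (axis i 1) v = v $ i"
proof -
  have "cnj (axis i (1::complex) $ k) * v $ k = (if k = i then v $ k else 0)" for k
    by (auto simp: axis_def)
  then show ?thesis
    by (simp add: cinner_def)
qed

lemma matrix_eqI:
  assumes "\<And>v. A *v v = (B *v v :: complex ^ 'n)"
  shows "A = B"
  using assms by (simp add: matrix_eq)

subsection \<open>Positive semidefinite matrices\<close>

text \<open>Polarization: the form is real at \<open>u + v\<close> and at
  \<open>u + \<i> *s v\<close>, which controls the imaginary and the real part of
  \<open>cinner u (M *v v)\<close> respectively.\<close>

lemma psd_hermitian:
  assumes "psd M"
  shows "adj M = M"
proof -
  have real: "Im (cinner v (M *v v)) = 0" for v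
    using assms by (simp add: psd_def complex_nonneg_Reals_iff)
  have 1: "Im (cinner u (M *v v)) + Im (cinner v (M *v u)) = 0" for u v
    using real[of "u + v"] real[of u] real[of v]
    by (simp add: cinner_add_left cinner_add_right matrix_vector_right_distrib)
  have 2: "cinner u (M *v v) = cnj (cinner v (M *v u))" for u v
    using 1[of u v] 1[of u "\<i> *s v"]
    by (simp add: complex_eq_iff cinner_scale_left cinner_scale_right vec.scale)
  have "cnj (M $ j $ i) = M $ i $ j" for i j
    using 2[of "axis i 1" "axis j 1"] by (simp only: cinner_axis matrix_vector_mult_axis)
  then show ?thesis
    by (simp add: vec_eq_iff)
qed

lemma psdI_hermitian:
  assumes "adj M = M" and "\<And>v. 0 \<le> Re (cinner v (M *v v))"
  shows "psd M"
proof -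
  have "cinner v (M *v v) = cnj (cinner v (M *v v))" for v
    using cinner_adj[of v M v] cinner_commute[of "M *v v" v] assms(1) by simp
  then show ?thesis
    using assms(2) by (simp add: psd_def complex_nonneg_Reals_iff complex_eq_iff)
qed

text \<open>Here \<open>u\<close> minimizes the form on \<open>W\<close>, so the first variation
  along \<open>h\<close> must vanish; otherwise a small step from \<open>u\<close> along a multiple
  of \<open>h\<close> would make the form negative. It serves twice: with \<open>W = UNIV\<close>
  for null vectors of positive matrices, and with an invariant \<open>W\<close> for maximizers of
  the Rayleigh quotient.\<close>

lemma null_vector_of_nonneg_form:
  assumes herm: "adj N = N" and W: "\<And>u v c. u \<in> W \<Longrightarrow> v \<in> W \<Longrightarrow> u + c *s v \<in> W"
    and nonneg: "\<And>v. v \<in> W \<Longrightarrow> 0 \<le> Re (cinner v (N *v v))"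
    and u: "u \<in> W" "Re (cinner u (N *v u)) = 0" and h: "h \<in> W"
  shows "cinner h (N *v u) = 0"
proof (rule ccontr)
  define a where "a = cinner h (N *v u)"
  define b where "b = Re (cinner h (N *v h))"
  \<comment> \<open>This step size gives \<open>t * b < 1\<close>, so the quadratic cost
    \<open>t\<^sup>2 * (cmod a)\<^sup>2 * b\<close> stays below the linear gain
    \<open>2 * t * (cmod a)\<^sup>2\<close>.\<close>
  define t where "t = 1 / (b + 1)"
  assume "cinner h (N *v u) \<noteq> 0"
  then have a: "(cmod a)\<^sup>2 > 0" by (simp add: a_def)
  have b: "b \<ge> 0" using nonneg h by (simp add: b_def)
  then have t: "t > 0" "t * b < 1" by (auto simp: t_def field_simps)
  have a': "cinner u (N *v h) = cnj a"
    unfolding a_def using cinner_adj[of u N h] cinner_commute[of "N *v u" h] herm by simp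
  define c where "c = - (of_real t * a)"
  have c1: "cnj c * a = - of_real (t * (cmod a)\<^sup>2)" "c * cnj a = - of_real (t * (cmod a)\<^sup>2)"
    and c2: "cnj c * c = of_real (t\<^sup>2 * (cmod a)\<^sup>2)"
    by (simp_all add: c_def of_real_cmod_square mult_ac power2_eq_square[of t])
  have "0 \<le> Re (cinner (u + c *s h) (N *v (u + c *s h)))"
    using W nonneg u h by blast
  also have "cinner (u + c *s h) (N *v (u + c *s h)) =
      cinner u (N *v u) + c * cnj a + cnj c * a + (cnj c * c) * cinner h (N *v h)"
    by (simp add: cinner_add_left cinner_add_right matrix_vector_right_distrib vec.scale
        cinner_scale_left cinner_scale_right a' flip: a_def) (simp add: algebra_simps)
  also have "Re \<dots> = - (2 * t * (cmod a)\<^sup>2) + t\<^sup>2 * (cmod a)\<^sup>2 * b"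
    unfolding c1 c2 using u(2) by (simp add: b_def)
  also have "\<dots> = (t * (cmod a)\<^sup>2) * (t * b - 2)"
    by (simp add: algebra_simps power2_eq_square)
  also have "\<dots> < 0"
    using a t by (intro mult_pos_neg) auto
  finally show False by simp
qed

lemma psd_null_vector:
  assumes "psd M" and "cinner u (M *v u) = 0"
  shows "M *v u = 0"
proof -
  have "cinner (M *v u) (M *v u) = 0"
    by (rule null_vector_of_nonneg_form[where W = UNIV])
      (use assms psd_hermitian in \<open>auto simp: psd_def complex_nonneg_Reals_iff\<close>)
  then show ?thesis by simp
qed

subsection \<open>Spectral theorem\<close>

text \<open>By compactness the Rayleigh quotient attains a maximum \<open>l\<close> at some unit
  vector \<open>u\<close> of \<open>W\<close>. The form of \<open>N = l - M\<close> is then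
  nonnegative on \<open>W\<close> and vanishes at \<open>u\<close>, so \<open>N *v u\<close> is
  orthogonal to \<open>W\<close>; by invariance it also lies in \<open>W\<close>, hence is
  zero.\<close>

lemma hermitian_eigenvector:
  fixes M :: "complex ^ 'n ^ 'n"
  assumes herm: "adj M = M"
    and W: "\<And>u v c. u \<in> W \<Longrightarrow> v \<in> W \<Longrightarrow> u + c *s v \<in> W" "closed W"
    and inv: "\<And>v. v \<in> W \<Longrightarrow> M *v v \<in> W"
    and "v0 \<in> W" "v0 \<noteq> 0"
  obtains l u where "u \<in> W" "norm u = 1" "M *v u = of_real l *s u"
proof -
  define f where "f v = Re (cinner v (M *v v))" for v
  have zero: "0 \<in> W" using W(1)[OF \<open>v0 \<in> W\<close> \<open>v0 \<in> W\<close>, of "-1"] by simp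
  have scale: "c *s v \<in> W" if "v \<in> W" for c v
    using W(1)[OF zero that] by simp
  have scaleR: "r *\<^sub>R v = of_real r *s v" for r :: real and v :: "complex ^ 'n"
    by (simp add: vec_eq_iff scaleR_conv_of_real[where 'a = complex])
  have scaleR_W: "r *\<^sub>R v \<in> W" if "v \<in> W" for r v
    using scale[OF that, of "of_real r"] by (simp only: scaleR)
  have "continuous_on (W \<inter> sphere 0 1) f"
    unfolding f_def cinner_def matrix_vector_mult_def by (intro continuous_intros)
  moreover have "compact (W \<inter> sphere 0 1)"
    using W(2) by (simp add: closed_Int_compact)
  moreover have "(1 / norm v0) *\<^sub>R v0 \<in> W \<inter> sphere 0 1"
    using scaleR_W[OF \<open>v0 \<in> W\<close>] \<open>v0 \<noteq> 0\<close> by simp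
  ultimately obtain u where u: "u \<in> W \<inter> sphere 0 1" and max: "\<And>v. v \<in> W \<inter> sphere 0 1 \<Longrightarrow> f v \<le> f u"
    by (metis continuous_attains_sup empty_iff)
  define l where "l = f u"
  define N where "N = mat (of_real l) - M"
  have N: "N *v v = of_real l *s v - M *v v" for v
    by (simp add: N_def matrix_vector_mult_diff_rdistrib)
       (simp add: vec_eq_iff matrix_vector_mult_def mat_def if_distrib if_distribR cong: if_cong)
  have N_herm: "adj N = N"
    using herm by (auto simp: N_def vec_eq_iff mat_def)
  have form: "Re (cinner v (N *v v)) = l * (norm v)\<^sup>2 - f v" for v
    by (simp add: N f_def cinner_diff_right cinner_scale_right cinner_self flip: of_real_power)
  have nonneg: "0 \<le> Re (cinner v (N *v v))" if v: "v \<in> W" for v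
  proof (cases "v = 0")
    case False
    have "f ((1 / norm v) *\<^sub>R v) \<le> l"
      using scaleR_W[OF v] False max unfolding l_def by simp
    moreover have "f ((1 / norm v) *\<^sub>R v) = f v / (norm v)\<^sup>2"
      by (simp add: f_def scaleR cinner_scale_left cinner_scale_right vec.scale power2_eq_square
          flip: of_real_divide)
    ultimately show ?thesis
      using False by (simp add: form field_simps)
  qed simp
  have Nu: "N *v u \<in> W"
    using W(1)[OF scale[of u "of_real l"] inv[of u], of "-1"] u by (simp add: N)
  have "cinner (N *v u) (N *v u) = 0"
    by (rule null_vector_of_nonneg_form[OF N_herm W(1) nonneg _ _ Nu])
      (use u in \<open>auto simp: form l_def\<close>)
  then have "M *v u = of_real l *s u"
    by (simp add: N)
  then show ?thesis
    using that u by auto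
qed

text \<open>A dimension count done by a square matrix: the conjugated \<open>u i\<close> are its
  rows for \<open>i\<close> in \<open>I\<close> and all other rows are zero. Row \<open>k\<close> is
  zero, so the matrix is singular, and any nonzero kernel vector will do.\<close>

lemma exists_orthogonal_vector:
  fixes u :: "'n::finite \<Rightarrow> complex ^ 'n"
  assumes "k \<notin> I"
  obtains v where "v \<noteq> 0" "\<And>i. i \<in> I \<Longrightarrow> cinner (u i) v = 0"
proof -
  define A :: "complex ^ 'n ^ 'n" where "A = (\<chi> i j. if i \<in> I then cnj (u i $ j) else 0)"
  have "\<nexists>B. A ** B = mat 1"
  proof
    assume "\<exists>B. A ** B = mat 1"
    then obtain B where "A ** B = mat 1" ..
    then have "(A ** B) $ k $ k = 1" by (simp add: mat_def)
    then show False using assms by (simp add: matrix_matrix_mult_def A_def)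
  qed
  then have "\<nexists>B. B ** A = mat 1"
    using matrix_left_right_inverse by blast
  then obtain v where v: "A *v v = 0" "v \<noteq> 0"
    unfolding matrix_left_invertible_ker by blast
  moreover have "cinner (u i) v = (A *v v) $ i" if "i \<in> I" for i
    using that by (simp add: cinner_def A_def matrix_vector_mult_def)
  ultimately show ?thesis
    using that by simp
qed

text \<open>Induction over subsets of the index type, so that the case \<open>I = UNIV\<close>
  yields a full eigenbasis. The next eigenvector is sought in the orthogonal complement
  \<open>W\<close> of those already found.\<close>

lemma hermitian_orthonormal_eigenvectors:
  fixes M :: "complex ^ 'n ^ 'n" and I :: "'n set"
  assumes "adj M = M"
  shows "\<exists>u l. (\<forall>i\<in>I. \<forall>j\<in>I. cinner (u i) (u j) = (if i = j then 1 else 0)) \<and>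
               (\<forall>i\<in>I. M *v u i = of_real (l i) *s u i)"
  using finite[of I]
proof (induction I)
  case (insert k I)
  then obtain u l where on: "\<And>i j. i \<in> I \<Longrightarrow> j \<in> I \<Longrightarrow> cinner (u i) (u j) = (if i = j then 1 else 0)"
    and ev: "\<And>i. i \<in> I \<Longrightarrow> M *v u i = of_real (l i) *s u i"
    by metis
  define W where "W = {v. \<forall>i\<in>I. cinner (u i) v = 0}"
  obtain v0 where v0: "v0 \<in> W" "v0 \<noteq> 0"
  proof (rule exists_orthogonal_vector[OF \<open>k \<notin> I\<close>])
    fix v assume "v \<noteq> 0" "\<And>i. i \<in> I \<Longrightarrow> cinner (u i) v = 0"
    then show ?thesis by (intro that) (auto simp: W_def)
  qed
  have "W = (\<Inter>i\<in>I. {v. cinner (u i) v = 0})"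
    by (auto simp: W_def)
  then have "closed W"
    unfolding cinner_def by (auto intro!: closed_INT closed_Collect_eq continuous_intros)
  \<comment> \<open>Moving \<open>M\<close> to the left slot turns
    \<open>cinner (u i) (M *v v)\<close> into a multiple of \<open>cinner (u i) v\<close>, which is
    zero.\<close>
  moreover have "M *v v \<in> W" if "v \<in> W" for v
    using that assms ev by (simp add: W_def cinner_adj cinner_scale_left)
  ultimately obtain m w where w: "w \<in> W" "norm w = 1" "M *v w = of_real m *s w"
    by (rule hermitian_eigenvector[OF assms _ _ _ v0(1) v0(2), rotated])
      (auto simp: W_def cinner_add_right cinner_scale_right)
  have "cinner w w = 1" "\<forall>i\<in>I. cinner (u i) w = 0" "\<forall>i\<in>I. cinner w (u i) = 0"
    using w cinner_commute[of w] by (auto simp: W_def cinner_self)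
  then show ?case
    using on ev w(3) \<open>k \<notin> I\<close>
    by (intro exI[of _ "u(k := w)"] exI[of _ "l(k := m)"]) auto
qed simp

section \<open>Diagonal matrices and functions of a diagonalized operator\<close>

definition diag :: "('n::finite \<Rightarrow> complex) \<Rightarrow> complex ^ 'n ^ 'n" where
  "diag d = (\<chi> i j. if i = j then d i else 0)"

lemma diag_mult_component: "(diag d ** A) $ i $ j = d i * A $ i $ j"
  by (simp add: diag_def matrix_matrix_mult_def if_distrib[of "\<lambda>x. x * _"] cong: if_cong)

lemma mult_diag_component: "(A ** diag d) $ i $ j = A $ i $ j * d j"
  by (simp add: diag_def matrix_matrix_mult_def if_distrib cong: if_cong)

lemma diag_vector_component: "(diag d *v v) $ i = d i * v $ i"
  by (simp add: diag_def matrix_vector_mult_def if_distrib[of "\<lambda>x. x * _"] cong: if_cong)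

lemma diag_mult_diag: "diag d ** diag e = diag (\<lambda>i. d i * e i)"
  by (simp add: vec_eq_iff diag_mult_component) (simp add: diag_def)

text \<open>For unitary \<open>U\<close> and varying \<open>d\<close> these are the functions of one
  hermitian operator; identities between them reduce to scalar identities between
  eigenvalues.\<close>

definition spectral_mat :: "complex ^ 'n ^ 'n \<Rightarrow> ('n::finite \<Rightarrow> real) \<Rightarrow> complex ^ 'n ^ 'n" where
  "spectral_mat U d = U ** diag (\<lambda>i. of_real (d i)) ** adj U"

lemma spectral_mat_hermitian: "adj (spectral_mat U d) = spectral_mat U d"
proof -
  have "adj (diag (\<lambda>i. of_real (d i))) = diag (\<lambda>i. of_real (d i))"
    by (auto simp: vec_eq_iff diag_def)
  then show ?thesis
    by (simp add: spectral_mat_def adj_mult matrix_mul_assoc)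
qed

lemma spectral_mat_mult:
  assumes "adj U ** U = mat 1"
  shows "spectral_mat U d ** spectral_mat U e = spectral_mat U (\<lambda>i. d i * e i)"
proof -
  have "spectral_mat U d ** spectral_mat U e =
      U ** diag (\<lambda>i. of_real (d i)) ** (adj U ** U) ** diag (\<lambda>i. of_real (e i)) ** adj U"
    by (simp add: spectral_mat_def matrix_mul_assoc)
  also have "\<dots> = U ** (diag (\<lambda>i. of_real (d i)) ** diag (\<lambda>i. of_real (e i))) ** adj U"
    by (simp add: assms matrix_mul_assoc)
  finally show ?thesis
    by (simp add: spectral_mat_def diag_mult_diag)
qed

lemma spectral_mat_psd:
  assumes "\<And>i. 0 \<le> d i"
  shows "psd (spectral_mat U d)"
proof (rule psdI_hermitian[OF spectral_mat_hermitian])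
  fix v
  define w where "w = adj U *v v"
  have "cinner v (spectral_mat U d *v v) = cinner w (diag (\<lambda>i. of_real (d i)) *v w)"
    by (simp add: spectral_mat_def w_def cinner_adj[of v U] flip: matrix_vector_mul_assoc)
  also have "\<dots> = (\<Sum>i\<in>UNIV. of_real (d i * (cmod (w $ i))\<^sup>2))"
    by (simp add: cinner_def diag_vector_component of_real_cmod_square mult_ac)
  also have "Re \<dots> \<ge> 0"
    by (simp add: assms sum_nonneg)
  finally show "0 \<le> Re (cinner v (spectral_mat U d *v v))" .
qed

lemma hermitian_spectral:
  fixes M :: "complex ^ 'n ^ 'n"
  assumes "adj M = M"
  obtains U d where "adj U ** U = mat 1" "U ** adj U = mat 1" "M = spectral_mat U d"
proof -
  obtain u and d :: "'n \<Rightarrow> real" where on: "\<And>i j. cinner (u i) (u j) = (if i = j then 1 else 0)"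
    and ev: "\<And>i. M *v u i = of_real (d i) *s u i"
    using hermitian_orthonormal_eigenvectors[OF assms, of UNIV] by (metis UNIV_I)
  define U where "U = (\<chi> i j. u j $ i)"
  have U: "adj U ** U = mat 1"
    using on by (simp add: vec_eq_iff matrix_matrix_mult_def U_def mat_def cinner_def)
  then have U': "U ** adj U = mat 1"
    using matrix_left_right_inverse by blast
  have "(M ** U) $ i $ j = (M *v u j) $ i" for i j
    by (simp add: matrix_matrix_mult_def U_def matrix_vector_mult_def)
  then have "M ** U = U ** diag (\<lambda>i. of_real (d i))"
    by (simp add: vec_eq_iff ev mult_diag_component) (simp add: U_def)
  then have "M ** (U ** adj U) = spectral_mat U d"
    by (simp add: spectral_mat_def matrix_mul_assoc)
  then show ?thesis
    using U U' that by (simp add: U')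
qed

lemma psd_spectral:
  fixes M :: "complex ^ 'n ^ 'n"
  assumes "psd M"
  obtains U d where "adj U ** U = mat 1" "U ** adj U = mat 1" "M = spectral_mat U d" "\<And>i. 0 \<le> d i"
proof -
  obtain U d where U: "adj U ** U = mat 1" "U ** adj U = mat 1" and M: "M = spectral_mat U d"
    using hermitian_spectral psd_hermitian assms by blast
  have "0 \<le> d i" for i
  proof -
    have "adj U *v (U *v axis i 1) = axis i 1"
      by (simp add: matrix_vector_mul_assoc U)
    then have "cinner (U *v axis i 1) (M *v (U *v axis i 1)) =
        cinner (axis i 1) (diag (\<lambda>i. of_real (d i)) *v axis i 1)"
      by (simp add: M spectral_mat_def cinner_adj[of _ U] flip: matrix_vector_mul_assoc)
    also have "\<dots> = of_real (d i)"
      by (simp add: cinner_axis matrix_vector_mult_axis diag_def)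
    finally show ?thesis
      using assms by (metis psd_def nonneg_Reals_of_real_iff)
  qed
  then show ?thesis
    using that U M by blast
qed

text \<open>The change of basis \<open>Z = adj U ** V\<close> intertwines the squared eigenvalues.
  Where \<open>Z $ i $ j\<close> is nonzero, the squares of \<open>d i\<close> and
  \<open>e j\<close> agree, hence so do the nonnegative numbers themselves; thus \<open>Z\<close>
  intertwines the roots too.\<close>

lemma psd_sqrt_unique:
  assumes "psd S" "psd T" and eq: "S ** S = T ** T"
  shows "S = T"
proof -
  obtain U d where U: "adj U ** U = mat 1" "U ** adj U = mat 1" and S: "S = spectral_mat U d"
    and d: "\<And>i. 0 \<le> d i"
    using psd_spectral[OF \<open>psd S\<close>] by blast
  obtain V e where V: "adj V ** V = mat 1" "V ** adj V = mat 1" and T: "T = spectral_mat V e"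
    and e: "\<And>i. 0 \<le> e i"
    using psd_spectral[OF \<open>psd T\<close>] by blast
  define Z where "Z = adj U ** V"
  have conj: "adj U ** spectral_mat U f ** V = diag (\<lambda>i. of_real (f i)) ** Z"
    "adj U ** spectral_mat V f ** V = Z ** diag (\<lambda>i. of_real (f i))" for f
    by (simp_all add: spectral_mat_def Z_def matrix_mul_assoc U)
       (simp add: V flip: matrix_mul_assoc)
  have eq': "diag (\<lambda>i. of_real (d i * d i)) ** Z = Z ** diag (\<lambda>i. of_real (e i * e i))"
    using eq unfolding conj[symmetric] S T
    by (simp only: spectral_mat_mult[OF U(1)] spectral_mat_mult[OF V(1)])
  have "of_real (d i) * Z $ i $ j = Z $ i $ j * of_real (e j)" for i j
  proof (cases "Z $ i $ j = 0")
    case False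
    have "of_real (d i * d i) * Z $ i $ j = of_real (e j * e j) * Z $ i $ j"
      using arg_cong[OF eq', of "\<lambda>A. A $ i $ j"]
      unfolding diag_mult_component mult_diag_component by (simp only: mult.commute)
    with False have "complex_of_real (d i * d i) = of_real (e j * e j)"
      by (simp only: mult_cancel_right) simp
    then have "(d i)\<^sup>2 = (e j)\<^sup>2"
      by (simp only: of_real_eq_iff power2_eq_square)
    then have "d i = e j"
      using d e by (simp add: power2_eq_iff_nonneg)
    then show ?thesis by simp
  qed simp
  then have "diag (\<lambda>i. of_real (d i)) ** Z = Z ** diag (\<lambda>i. of_real (e i))"
    by (simp add: vec_eq_iff diag_mult_component mult_diag_component)
  then have "U ** (adj U ** S ** V) ** adj V = U ** (adj U ** T ** V) ** adj V"
    by (simp add: conj S T)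
  moreover have "U ** (adj U ** X ** V) ** adj V = X" for X
    by (simp add: matrix_mul_assoc U) (simp add: V flip: matrix_mul_assoc)
  ultimately show ?thesis
    by simp
qed

lemma psd_sqrt_eqI:
  assumes "psd S" "S ** S = M"
  shows "psd_sqrt M = S"
  unfolding psd_sqrt_def using assms by (intro the_equality) (auto intro: psd_sqrt_unique)

subsection \<open>Supports\<close>

text \<open>The part \<open>u = v - P *v v\<close> lies in the kernel of \<open>P\<close>, hence is
  orthogonal to \<open>v\<close> by assumption and to \<open>P *v v\<close> by hermiticity, so it is
  orthogonal to itself.\<close>

lemma ortho_compl_kernel_projector:
  assumes "adj P = P" "P ** P = P"
  shows "ortho_compl {v. P *v v = 0} = {v. P *v v = v}"
proof (intro equalityI subsetI)
  fix v assume v: "v \<in> ortho_compl {v. P *v v = 0}"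
  define u where "u = v - P *v v"
  have Pu: "P *v u = 0"
    by (simp add: u_def matrix_vector_mult_diff_distrib matrix_vector_mul_assoc assms)
  then have "cinner u v = 0"
    using v by (simp add: ortho_compl_def)
  moreover have "cinner u (P *v v) = 0"
    using Pu by (simp add: cinner_adj assms)
  ultimately have "cinner u u = 0"
    by (subst (2) u_def) (simp add: cinner_diff_right)
  then show "v \<in> {v. P *v v = v}"
    by (simp add: u_def)
next
  fix v assume v: "v \<in> {v. P *v v = v}"
  have "cinner u v = 0" if "P *v u = 0" for u
    using v that cinner_adj[of u P v] assms by simp
  then show "v \<in> ortho_compl {v. P *v v = 0}"
    by (simp add: ortho_compl_def)
qed

lemma ortho_compl_range_projector:
  assumes "adj P = P" "P ** P = P"
  shows "ortho_compl {v. P *v v = v} = {v. P *v v = 0}"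
proof (intro equalityI subsetI)
  fix v assume "v \<in> ortho_compl {v. P *v v = v}"
  then have "cinner (P *v v) v = 0"
    by (simp add: ortho_compl_def matrix_vector_mul_assoc assms)
  then have "cinner (P *v v) (P *v v) = 0"
    by (simp add: cinner_adj[of "P *v v"] matrix_vector_mul_assoc assms)
  then show "v \<in> {v. P *v v = 0}" by simp
next
  fix v assume v: "v \<in> {v. P *v v = 0}"
  have "cinner u v = 0" if "P *v u = u" for u
    using v that cinner_adj[of u P v] assms by simp
  then show "v \<in> ortho_compl {v. P *v v = v}"
    by (simp add: ortho_compl_def)
qed

text \<open>The range condition amounts to \<open>P ** X = X\<close> and the vanishing condition to
  \<open>X ** P = X\<close>. From here on, membership in \<open>ops_on\<close> is handled as this
  matrix equation.\<close>

lemma ops_on_projector: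
  assumes "adj P = P" "P ** P = P"
  shows "ops_on {v. P *v v = v} = {X. P ** X ** P = X}"
proof (intro equalityI subsetI)
  fix X assume X: "X \<in> ops_on {v. P *v v = v}"
  have "P ** X = X"
    by (rule matrix_eqI) (use X in \<open>simp add: ops_on_def flip: matrix_vector_mul_assoc\<close>)
  moreover have "X *v v = X *v (P *v v)" for v
  proof -
    have "X *v (v - P *v v) = 0"
    proof -
      have "P *v (v - P *v v) = 0"
        by (simp add: assms matrix_vector_mult_diff_distrib matrix_vector_mul_assoc)
      then show ?thesis
        using X assms by (simp add: ops_on_def ortho_compl_range_projector)
    qed
    then show ?thesis by (simp add: matrix_vector_mult_diff_distrib)
  qed
  then have "X ** P = X"
    by (intro matrix_eqI) (simp flip: matrix_vector_mul_assoc)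
  ultimately show "X \<in> {X. P ** X ** P = X}" by simp
next
  fix X assume "X \<in> {X. P ** X ** P = X}"
  then have X: "P ** X ** P = X" by simp
  have "P *v (X *v v) = X *v v" for v
    by (metis X assms(2) matrix_mul_assoc matrix_vector_mul_assoc)
  moreover have "X *v v = 0" if "P *v v = 0" for v
    by (metis X that matrix_vector_mul_assoc matrix_vector_mult_0_right)
  ultimately show "X \<in> ops_on {v. P *v v = v}"
    using assms by (simp add: ops_on_def ortho_compl_range_projector)
qed

lemma ortho_projector_eqI:
  assumes "adj P = P" "P ** P = P"
  shows "ortho_projector {v. P *v v = v} = P"
  unfolding ortho_projector_def
proof (rule the_equality)
  show "(\<forall>v\<in>{v. P *v v = v}. P *v v = v) \<and> (\<forall>v\<in>ortho_compl {v. P *v v = v}. P *v v = 0)"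
    using assms by (simp add: ortho_compl_range_projector)
next
  fix Y assume "(\<forall>v\<in>{v. P *v v = v}. Y *v v = v) \<and> (\<forall>v\<in>ortho_compl {v. P *v v = v}. Y *v v = 0)"
  then have Y: "\<And>v. P *v v = v \<Longrightarrow> Y *v v = v" "\<And>v. P *v v = 0 \<Longrightarrow> Y *v v = 0"
    using assms by (simp_all add: ortho_compl_range_projector)
  show "Y = P"
  proof (rule matrix_eqI)
    fix v
    have "Y *v (P *v v) = P *v v" "Y *v (v - P *v v) = 0"
      by (rule Y, simp add: matrix_vector_mult_diff_distrib matrix_vector_mul_assoc assms)+
    then show "Y *v v = P *v v"
      by (simp add: matrix_vector_mult_diff_distrib)
  qed
qed

text \<open>If \<open>M *v v = 0\<close> then \<open>P *v v = X *v (M *v v) = 0\<close>; if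
  \<open>P *v v = 0\<close> then \<open>M *v v = M *v (P *v v) = 0\<close>. The supports follow by
  taking complements.\<close>

lemma supp_eq_projector_range:
  assumes "adj P = P" "P ** P = P" and "X ** M = P" "M ** P = M"
  shows "ker M = {v. P *v v = 0}" "supp M = {v. P *v v = v}"
proof -
  show "ker M = {v. P *v v = 0}"
    unfolding ker_def using assms(3,4)
    by (metis (no_types, opaque_lifting) matrix_vector_mul_assoc matrix_vector_mult_0_right)
  then show "supp M = {v. P *v v = v}"
    using assms by (simp add: supp_def ortho_compl_kernel_projector)
qed

text \<open>For uniqueness, split \<open>v\<close> into \<open>P *v v\<close> and
  \<open>v - P *v v\<close>: the first is \<open>M\<close> applied to the support vector
  \<open>X *v v\<close>, which fixes the value there, and the second lies in the kernel.\<close>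

lemma supp_inverse_eqI:
  assumes P: "adj P = P" "P ** P = P"
    and X: "X ** M = P" "M ** X = P" "X ** P = X" "P ** X = X" and M: "M ** P = M"
  shows "supp_inverse M = X"
  unfolding supp_inverse_def supp_eq_projector_range[OF P X(1) M]
proof (rule the_equality)
  have "X *v v = 0" if "P *v v = 0" for v
    by (metis X(3) that matrix_vector_mul_assoc matrix_vector_mult_0_right)
  then show "(\<forall>v\<in>{v. P *v v = v}. X *v (M *v v) = v) \<and> (\<forall>v\<in>{v. P *v v = 0}. X *v v = 0)"
    by (simp add: matrix_vector_mul_assoc X)
next
  fix Y assume Y: "(\<forall>v\<in>{v. P *v v = v}. Y *v (M *v v) = v) \<and> (\<forall>v\<in>{v. P *v v = 0}. Y *v v = 0)"
  show "Y = X"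
  proof (rule matrix_eqI)
    fix v
    have "P *v (X *v v) = X *v v"
      by (simp add: X matrix_vector_mul_assoc)
    then have "Y *v (M *v (X *v v)) = X *v v"
      using Y by blast
    then have "Y *v (P *v v) = X *v v"
      by (metis X(2) matrix_vector_mul_assoc)
    moreover have "P *v (v - P *v v) = 0"
      by (simp add: matrix_vector_mult_diff_distrib matrix_vector_mul_assoc P)
    then have "Y *v (v - P *v v) = 0"
      using Y by blast
    ultimately show "Y *v v = X *v v"
      by (simp add: matrix_vector_mult_diff_distrib)
  qed
qed

text \<open>One diagonalization of \<open>M\<close> makes the root, the inverse root and the support
  projector diagonal in the same basis, so every product is checked eigenvalue by
  eigenvalue.\<close>

lemma psd_support_calculus:
  fixes M :: "complex ^ 'n ^ 'n"
  assumes "psd M"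
  defines "s \<equiv> psd_sqrt M" and "w \<equiv> psd_sqrt (supp_inverse M)" and "P \<equiv> ortho_projector (supp M)"
  shows "adj s = s" "adj w = w" "adj P = P" "P ** P = P" "s ** s = M"
    "w ** s = P" "s ** w = P" "w ** P = w" "P ** w = w" "s ** P = s" "P ** s = s"
    "ker M = {v. P *v v = 0}"
    "ops_on (supp (transpose M)) = {X. transpose P ** X ** transpose P = X}"
proof -
  obtain U d where U: "adj U ** U = mat 1" and M: "M = spectral_mat U d" and d: "\<And>i. 0 \<le> d i"
    using psd_spectral[OF \<open>psd M\<close>] by blast
  note mult = spectral_mat_mult[OF U]
  define S where "S = spectral_mat U (\<lambda>i. sqrt (d i))"
  \<comment> \<open>Since \<open>1 / 0 = 0\<close>, the matrices \<open>W\<close> and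
    \<open>X\<close> vanish on the kernel of \<open>M\<close>, just as the extension by zero
    demands.\<close>
  define W where "W = spectral_mat U (\<lambda>i. 1 / sqrt (d i))"
  define X where "X = spectral_mat U (\<lambda>i. 1 / d i)"
  define Q where "Q = spectral_mat U (\<lambda>i. if d i = 0 then 0 else 1)"
  have mults: "S ** S = M" "W ** W = X" "Q ** Q = Q" "X ** M = Q" "M ** X = Q" "X ** Q = X"
    "Q ** X = X" "M ** Q = M" "Q ** M = M" "W ** S = Q" "S ** W = Q" "W ** Q = W" "Q ** W = W"
    "S ** Q = S" "Q ** S = S"
    unfolding S_def W_def Q_def X_def M mult
    using d by (auto intro!: arg_cong[of _ _ "spectral_mat U"] ext)
  have herm: "adj S = S" "adj W = W" "adj Q = Q" "adj M = M"
    by (simp_all add: S_def W_def Q_def M spectral_mat_hermitian)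
  have psd: "psd S" "psd W"
    unfolding S_def W_def using d by (auto intro!: spectral_mat_psd)
  have s: "s = S"
    unfolding s_def by (rule psd_sqrt_eqI) (simp_all add: psd mults)
  have "supp_inverse M = X"
    by (rule supp_inverse_eqI[of Q]) (simp_all add: herm mults)
  then have w: "w = W"
    unfolding w_def by (simp add: psd_sqrt_eqI psd mults)
  have supp: "ker M = {v. Q *v v = 0}" "supp M = {v. Q *v v = v}"
    using supp_eq_projector_range[of Q X M] by (simp_all add: herm mults)
  then have P: "P = Q"
    unfolding P_def by (simp add: ortho_projector_eqI herm mults)
  show "adj s = s" "adj w = w" "adj P = P" "P ** P = P" "s ** s = M"
    "w ** s = P" "s ** w = P" "w ** P = w" "P ** w = w" "s ** P = s" "P ** s = s"
    "ker M = {v. P *v v = 0}"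
    by (simp_all add: s w P herm mults supp)
  have Qt: "adj (transpose Q) = transpose Q" "transpose Q ** transpose Q = transpose Q"
    by (simp_all add: adj_transpose herm mults flip: matrix_transpose_mul)
  \<comment> \<open>Transposition reverses products, so \<open>transpose X\<close> is a left partial
    inverse of \<open>transpose M\<close> because \<open>M ** X = Q\<close>.\<close>
  have "supp (transpose M) = {v. transpose Q *v v = v}"
    by (rule supp_eq_projector_range[where X = "transpose X"])
      (simp_all add: Qt mults flip: matrix_transpose_mul)
  then show "ops_on (supp (transpose M)) = {X. transpose P ** X ** transpose P = X}"
    by (simp only: P ops_on_projector[OF Qt])
qed

section \<open>Transposes and rank of density operators\<close>

lemma psd_transpose:
  assumes "psd M"
  shows "psd (transpose M)"
proof -
  have "cinner v (transpose M *v v) = cinner (\<chi> i. cnj (v $ i)) (M *v (\<chi> i. cnj (v $ i)))" for v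
  proof -
    have "cinner v (transpose M *v v) = (\<Sum>i\<in>UNIV. \<Sum>j\<in>UNIV. cnj (v $ i) * M $ j $ i * v $ j)"
      by (simp add: cinner_def matrix_vector_mult_def transpose_def sum_distrib_left mult.assoc)
    also have "\<dots> = (\<Sum>j\<in>UNIV. \<Sum>i\<in>UNIV. cnj (v $ i) * M $ j $ i * v $ j)"
      by (rule sum.swap)
    finally show ?thesis
      by (simp add: cinner_def matrix_vector_mult_def sum_distrib_left mult_ac)
  qed
  then show ?thesis
    using assms by (simp add: psd_def)
qed

lemma trace_transpose [simp]: "trace (transpose M) = trace M"
  by (simp add: trace_def transpose_def)

lemma density_ops_transpose: "M \<in> density_ops \<Longrightarrow> transpose M \<in> density_ops"
  by (simp add: density_ops_def psd_transpose)

text \<open>Rank zero forces every row to vanish. This is what allows the factor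
  \<open>1 / rank\<close> in \<open>sigma\<close> to be cancelled.\<close>

lemma rank_neq_0:
  fixes M :: "complex ^ 'n ^ 'n"
  assumes "trace M \<noteq> 0"
  shows "rank M \<noteq> 0"
proof
  assume "rank M = 0"
  then have "row i M = 0" for i
    by (auto simp: row_rank_def_gen rows_def)
  then have "M = 0"
    by (simp add: row_def vec_eq_iff)
  then show False
    using assms by (simp add: trace_def)
qed

subsection \<open>Matrices as maps: the Choi correspondence\<close>

lemma block_component [simp]: "block X j k $ a $ c = X $ (j, a) $ (k, c)"
  by (simp add: block_def)

lemma block_id_tensor [simp]: "block (id_tensor E X) j k = E (block X j k)"
  by (simp add: vec_eq_iff id_tensor_def)

lemma block_eqI:
  assumes "\<And>j k. block X j k = block Y j k"
  shows "X = Y"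
proof -
  have "X $ (j, a) $ (k, c) = Y $ (j, a) $ (k, c)" for j a k c
    using assms by (metis block_component)
  then show ?thesis by (simp add: vec_eq_iff)
qed

lemma sum_UNIV_prod: "(\<Sum>p\<in>UNIV. f p) = (\<Sum>j\<in>UNIV. \<Sum>b\<in>UNIV. f (j, b))"
  by (simp add: sum.cartesian_product flip: UNIV_Times_UNIV)

lemma tensor_one_mult_component:
  "(tensor_mat A (mat 1) ** X) $ (j, b) $ q = (\<Sum>l\<in>UNIV. A $ j $ l * X $ (l, b) $ q)"
  by (simp add: matrix_matrix_mult_def tensor_mat_def sum_UNIV_prod mat_def
      if_distrib[of "\<lambda>x. _ * x"] if_distrib[of "\<lambda>x. x * _"] cong: if_cong)

lemma mult_tensor_one_component:
  "(X ** tensor_mat B (mat 1)) $ p $ (k, c) = (\<Sum>m\<in>UNIV. X $ p $ (m, c) * B $ m $ k)"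
  by (simp add: matrix_matrix_mult_def tensor_mat_def sum_UNIV_prod mat_def
      if_distrib[of "\<lambda>x. _ * x"] if_distrib[of "\<lambda>x. x * _"] cong: if_cong)

lemma adj_tensor_one: "adj (tensor_mat A (mat 1)) = tensor_mat (adj A) (mat 1)"
  by (simp add: vec_eq_iff tensor_mat_def mat_def)

text \<open>This is \<open>Tr_A((X^T \<otimes> I) \<tau>)\<close>, the map having
  \<open>\<tau>\<close> as its unnormalized Choi matrix.\<close>

definition choi_map ::
  "complex ^ ('a::finite \<times> 'b) ^ ('a \<times> 'b) \<Rightarrow> complex ^ 'a ^ 'a \<Rightarrow> complex ^ 'b ^ 'b" where
  "choi_map \<tau> X = (\<chi> b c. \<Sum>j\<in>UNIV. \<Sum>k\<in>UNIV. X $ j $ k * \<tau> $ (j, b) $ (k, c))"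

lemma choi_map_component:
  "choi_map \<tau> X $ b $ c = (\<Sum>j\<in>UNIV. \<Sum>k\<in>UNIV. X $ j $ k * \<tau> $ (j, b) $ (k, c))"
  by (simp add: choi_map_def)

lemma sum_swap_outer_inner:
  "(\<Sum>x\<in>A. \<Sum>y\<in>B. \<Sum>z\<in>C. f x y z) = (\<Sum>z\<in>C. \<Sum>y\<in>B. \<Sum>x\<in>A. f x y z)"
proof -
  have "(\<Sum>x\<in>A. \<Sum>y\<in>B. \<Sum>z\<in>C. f x y z) = (\<Sum>y\<in>B. \<Sum>x\<in>A. \<Sum>z\<in>C. f x y z)"
    by (rule sum.swap)
  also have "\<dots> = (\<Sum>y\<in>B. \<Sum>z\<in>C. \<Sum>x\<in>A. f x y z)"
    by (intro sum.cong refl sum.swap)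
  also have "\<dots> = (\<Sum>z\<in>C. \<Sum>y\<in>B. \<Sum>x\<in>A. f x y z)"
    by (rule sum.swap)
  finally show ?thesis .
qed

text \<open>The contraction of \<open>A\<close> with the row index of \<open>\<tau>\<close> can be
  carried out on the row index of \<open>X\<close> instead; \<open>A\<close> then acts through its
  other index, which is where the transpose comes from.\<close>

lemma choi_map_tensor_left:
  "choi_map (tensor_mat A (mat 1) ** \<tau>) X = choi_map \<tau> (transpose A ** X)"
proof -
  have AX: "(transpose A ** X) $ l $ k = (\<Sum>j\<in>UNIV. A $ j $ l * X $ j $ k)" for l k
    by (simp add: matrix_matrix_mult_def transpose_def)
  have "choi_map (tensor_mat A (mat 1) ** \<tau>) X $ b $ c = choi_map \<tau> (transpose A ** X) $ b $ c" for b c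
    by (simp add: choi_map_component tensor_one_mult_component AX sum_distrib_left sum_distrib_right)
      (subst sum_swap_outer_inner, simp add: mult_ac)
  then show ?thesis by (simp add: vec_eq_iff)
qed

lemma choi_map_tensor_right:
  "choi_map (\<tau> ** tensor_mat B (mat 1)) X = choi_map \<tau> (X ** transpose B)"
proof -
  have "(\<Sum>k\<in>UNIV. X $ j $ k * (\<tau> ** tensor_mat B (mat 1)) $ (j, b) $ (k, c)) =
      (\<Sum>m\<in>UNIV. (X ** transpose B) $ j $ m * \<tau> $ (j, b) $ (m, c))" for j b c
    by (simp add: mult_tensor_one_component matrix_matrix_mult_def[of X]
        transpose_def sum_distrib_left sum_distrib_right)
      (subst sum.swap, simp add: mult_ac)
  then show ?thesis by (simp add: vec_eq_iff choi_map_component)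
qed

lemma choi_map_sandwich:
  "choi_map (tensor_mat A (mat 1) ** \<tau> ** tensor_mat B (mat 1)) X =
     choi_map \<tau> (transpose A ** X ** transpose B)"
  by (simp add: choi_map_tensor_left choi_map_tensor_right matrix_mul_assoc)

section \<open>Matrix units, linearity and trace of the Choi map\<close>

definition matrix_unit :: "'a::finite \<Rightarrow> 'a \<Rightarrow> complex ^ 'a ^ 'a" where
  "matrix_unit j k = ketbra (axis j 1) (axis k 1)"

lemma matrix_unit_sandwich: "(A ** matrix_unit j k ** B) $ a $ c = A $ a $ j * B $ k $ c"
proof -
  have "(A ** matrix_unit j k) $ a $ l = (if l = k then A $ a $ j else 0)" for l
    by (simp add: matrix_unit_def ketbra_def matrix_matrix_mult_def axis_def
        if_distrib[of "\<lambda>x. _ * x"] cong: if_cong)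
  then show ?thesis
    by (subst matrix_matrix_mult_def) (simp add: if_distrib[of "\<lambda>x. x * _"] cong: if_cong)
qed

lemma matrix_unit_component: "matrix_unit j k $ a $ c = (if a = j \<and> c = k then 1 else 0)"
  by (simp add: matrix_unit_def ketbra_def axis_def)

lemma choi_map_matrix_unit: "choi_map \<tau> (matrix_unit j k) = block \<tau> j k"
proof -
  have "(\<Sum>l\<in>UNIV. \<Sum>m\<in>UNIV. matrix_unit j k $ l $ m * \<tau> $ (l, b) $ (m, c)) = \<tau> $ (j, b) $ (k, c)" for b c
  proof -
    have "(\<Sum>m\<in>UNIV. matrix_unit j k $ l $ m * \<tau> $ (l, b) $ (m, c)) =
        (if l = j then \<tau> $ (j, b) $ (k, c) else 0)" for l
      by (cases "l = j") (simp_all add: matrix_unit_component if_distrib[of "\<lambda>x. x * _"] cong: if_cong)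
    then show ?thesis by simp
  qed
  then show ?thesis
    by (simp add: vec_eq_iff choi_map_component)
qed

lemma choi_map_add: "choi_map \<tau> (X + Y) = choi_map \<tau> X + choi_map \<tau> Y"
  by (simp add: vec_eq_iff choi_map_component distrib_right sum.distrib)

lemma choi_map_scale: "choi_map \<tau> (scale_mat c X) = scale_mat c (choi_map \<tau> X)"
  by (simp add: vec_eq_iff choi_map_component scale_mat_def sum_distrib_left mult.assoc)

text \<open>Summing the diagonal over \<open>b\<close> leaves only the marginal of
  \<open>\<tau>\<close>; trace preservation thereby becomes a statement about
  \<open>partial_trace_B \<tau>\<close>.\<close>

lemma trace_choi_map: "trace (choi_map \<tau> X) = trace (X ** transpose (partial_trace_B \<tau>))"
proof -
  have "trace (choi_map \<tau> X) = (\<Sum>b\<in>UNIV. \<Sum>j\<in>UNIV. \<Sum>k\<in>UNIV. X $ j $ k * \<tau> $ (j, b) $ (k, b))"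
    by (simp add: trace_def choi_map_component)
  also have "\<dots> = (\<Sum>j\<in>UNIV. \<Sum>b\<in>UNIV. \<Sum>k\<in>UNIV. X $ j $ k * \<tau> $ (j, b) $ (k, b))"
    by (rule sum.swap)
  also have "\<dots> = (\<Sum>j\<in>UNIV. \<Sum>k\<in>UNIV. \<Sum>b\<in>UNIV. X $ j $ k * \<tau> $ (j, b) $ (k, b))"
    by (intro sum.cong refl sum.swap)
  also have "\<dots> = trace (X ** transpose (partial_trace_B \<tau>))"
    by (simp add: trace_def matrix_matrix_mult_def transpose_def partial_trace_B_def sum_distrib_left)
  finally show ?thesis .
qed

lemma trace_partial_trace_B: "trace (partial_trace_B \<tau>) = trace \<tau>"
  by (simp add: trace_def partial_trace_B_def sum_UNIV_prod)

subsection \<open>Complete positivity\<close>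

lemma sum_nonneg_Reals:
  assumes "\<And>x. x \<in> A \<Longrightarrow> f x \<in> (\<real>\<^sub>\<ge>\<^sub>0 :: complex set)"
  shows "sum f A \<in> \<real>\<^sub>\<ge>\<^sub>0"
  using assms by (induction A rule: infinite_finite_induct) auto

lemma cinner_blocks:
  "cinner v (\<tau> *v v) =
     (\<Sum>j\<in>UNIV. \<Sum>k\<in>UNIV. cinner (\<chi> b. v $ (j, b)) (block \<tau> j k *v (\<chi> c. v $ (k, c))))"
proof -
  have "cinner v (\<tau> *v v) = (\<Sum>j\<in>UNIV. \<Sum>b\<in>UNIV. \<Sum>k\<in>UNIV. \<Sum>c\<in>UNIV.
      cnj (v $ (j, b)) * (\<tau> $ (j, b) $ (k, c) * v $ (k, c)))"
    by (simp add: cinner_def matrix_vector_mult_def sum_UNIV_prod sum_distrib_left)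
  also have "\<dots> = (\<Sum>j\<in>UNIV. \<Sum>k\<in>UNIV. \<Sum>b\<in>UNIV. \<Sum>c\<in>UNIV.
      cnj (v $ (j, b)) * (\<tau> $ (j, b) $ (k, c) * v $ (k, c)))"
    by (intro sum.cong refl sum.swap)
  finally show ?thesis
    by (simp add: cinner_def matrix_vector_mult_def sum_distrib_left)
qed

text \<open>The bridge between the arrays indexed by natural numbers in complete positivity and
  matrices over a finite type: \<open>e\<close> numbers the blocks, and a tuple of vectors is glued
  into a single vector along its inverse.\<close>

lemma psd_iff_block_psd:
  fixes \<tau> :: "complex ^ ('a::finite \<times> 'b::finite) ^ ('a \<times> 'b)"
  assumes e: "bij_betw e {..<n} (UNIV :: 'a set)"
  shows "psd \<tau> \<longleftrightarrow> block_psd n (\<lambda>i j. block \<tau> (e i) (e j))"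
proof -
  have reindex: "(\<Sum>j\<in>UNIV. \<Sum>k\<in>UNIV. f j k) = (\<Sum>i<n. \<Sum>i'<n. f (e i) (e i'))" for f :: "'a \<Rightarrow> 'a \<Rightarrow> complex"
    by (simp add: sum.reindex_bij_betw[OF e] flip: sum.reindex_bij_betw[OF e, of "\<lambda>j. sum (f j) UNIV"])
  show ?thesis
  proof
    assume "psd \<tau>"
    show "block_psd n (\<lambda>i j. block \<tau> (e i) (e j))"
      unfolding block_psd_def
    proof
      fix v :: "nat \<Rightarrow> complex ^ 'b"
      define V where "V = (\<chi> p. v (inv_into {..<n} e (fst p)) $ snd p)"
      have "(\<chi> b. V $ (e i, b)) = v i" if "i < n" for i
        using that e by (simp add: V_def vec_eq_iff bij_betw_def)
      then have "cinner V (\<tau> *v V) = (\<Sum>i<n. \<Sum>j<n. cinner (v i) (block \<tau> (e i) (e j) *v v j))"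
        unfolding cinner_blocks reindex by simp
      then show "(\<Sum>i<n. \<Sum>j<n. cinner (v i) (block \<tau> (e i) (e j) *v v j)) \<in> \<real>\<^sub>\<ge>\<^sub>0"
        using \<open>psd \<tau>\<close> by (metis psd_def)
    qed
  next
    assume "block_psd n (\<lambda>i j. block \<tau> (e i) (e j))"
    then show "psd \<tau>"
      unfolding psd_def cinner_blocks reindex block_psd_def
      by (intro allI) (erule allE[where x = "\<lambda>i. \<chi> b. v $ (e i, b)" for v])
  qed
qed

text \<open>Complete positivity is used with an ancilla of dimension \<open>CARD('k)\<close>, after
  numbering the basis of the first factor.\<close>

lemma psd_id_tensor:
  fixes X :: "complex ^ ('k::finite \<times> 'm::finite) ^ ('k \<times> 'm)"
  assumes E: "completely_positive_on S E" and X: "psd X" "\<And>j k. block X j k \<in> ops_on S"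
  shows "psd (id_tensor E X)"
proof -
  obtain e where e: "bij_betw e {..<CARD('k)} (UNIV :: 'k set)"
    using ex_bij_betw_nat_finite[of "UNIV :: 'k set"] by (auto simp: atLeast0LessThan)
  have "block_psd CARD('k) (\<lambda>i j. E (block X (e i) (e j)))"
    using E[unfolded completely_positive_on_def, rule_format] X psd_iff_block_psd[OF e, of X] by simp
  then show ?thesis
    by (simp add: psd_iff_block_psd[OF e])
qed

text \<open>The rows of \<open>s\<close>, reshaped into matrices, are Kraus operators of the map.\<close>

lemma choi_map_kraus:
  "choi_map (adj s ** s) X =
     (\<Sum>p\<in>UNIV. adj (\<chi> l b. s $ p $ (l, b)) ** X ** (\<chi> l b. s $ p $ (l, b)))"
proof -
  have "choi_map (adj s ** s) X $ b $ c =
      (\<Sum>l\<in>UNIV. \<Sum>m\<in>UNIV. \<Sum>p\<in>UNIV. cnj (s $ p $ (l, b)) * X $ l $ m * s $ p $ (m, c))" for b c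
    by (simp add: choi_map_component matrix_matrix_mult_def sum_distrib_left mult_ac)
  also have "\<dots> b c = (\<Sum>p\<in>UNIV. \<Sum>m\<in>UNIV. \<Sum>l\<in>UNIV. cnj (s $ p $ (l, b)) * X $ l $ m * s $ p $ (m, c))" for b c
    by (rule sum_swap_outer_inner)
  finally show ?thesis
    by (simp add: vec_eq_iff matrix_matrix_mult_def sum_distrib_right)
qed

text \<open>In Kraus form, each operator \<open>K p\<close> contributes the form of the array
  \<open>X\<close> evaluated at the tuple of the \<open>K p *v v i\<close>; a sum of such
  nonnegative numbers is nonnegative.\<close>

lemma completely_positive_choi_map:
  fixes \<tau> :: "complex ^ ('a::finite \<times> 'b::finite) ^ ('a \<times> 'b)"
  assumes "psd \<tau>"
  shows "completely_positive_on S (choi_map \<tau>)"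
proof -
  define s where "s = psd_sqrt \<tau>"
  have s: "\<tau> = adj s ** s"
    using psd_support_calculus[OF assms] by (simp add: s_def)
  define K where "K p = (\<chi> l b. s $ p $ (l, b))" for p
  have choi: "choi_map \<tau> X *v v = (\<Sum>p\<in>UNIV. adj (K p) *v (X *v (K p *v v)))" for X v
  proof -
    have "(sum A I) *v v = (\<Sum>p\<in>I. A p *v v)" for A :: "'c \<Rightarrow> complex ^ 'e ^ 'd" and I v
      by (induction I rule: infinite_finite_induct) (simp_all add: matrix_vector_mult_add_rdistrib)
    then show ?thesis
      by (simp add: s choi_map_kraus K_def matrix_vector_mul_assoc matrix_mul_assoc)
  qed
  have cinner_sum: "cinner w (sum f I) = (\<Sum>p\<in>I. cinner w (f p))" for w f I
    by (induction I rule: infinite_finite_induct) (simp_all add: cinner_add_right)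
  show ?thesis
    unfolding completely_positive_on_def
  proof (intro allI impI)
    fix n and X :: "nat \<Rightarrow> nat \<Rightarrow> complex ^ 'a ^ 'a" assume X: "block_psd n X"
    show "block_psd n (\<lambda>i j. choi_map \<tau> (X i j))"
      unfolding block_psd_def
    proof
      fix v
      have "(\<Sum>i<n. \<Sum>j<n. cinner (v i) (choi_map \<tau> (X i j) *v v j)) =
          (\<Sum>i<n. \<Sum>j<n. \<Sum>p\<in>UNIV. cinner (K p *v v i) (X i j *v (K p *v v j)))"
        by (simp add: choi cinner_sum cinner_adj[of _ "adj _"])
      also have "\<dots> = (\<Sum>p\<in>UNIV. \<Sum>j<n. \<Sum>i<n. cinner (K p *v v i) (X i j *v (K p *v v j)))"
        by (rule sum_swap_outer_inner)
      also have "\<dots> = (\<Sum>p\<in>UNIV. \<Sum>i<n. \<Sum>j<n. cinner (K p *v v i) (X i j *v (K p *v v j)))"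
        by (intro sum.cong refl sum.swap)
      also have "\<dots> \<in> \<real>\<^sub>\<ge>\<^sub>0"
        by (rule sum_nonneg_Reals) (use X in \<open>simp add: block_psd_def\<close>)
      finally show "(\<Sum>i<n. \<Sum>j<n. cinner (v i) (choi_map \<tau> (X i j) *v v j)) \<in> \<real>\<^sub>\<ge>\<^sub>0" .
    qed
  qed
qed

lemma psd_sandwich:
  assumes "psd M"
  shows "psd (adj A ** M ** A)"
  unfolding psd_def
proof
  fix v
  have "cinner v (adj A ** M ** A *v v) = cinner (A *v v) (M *v (A *v v))"
    by (simp add: cinner_adj[of _ "adj A"] flip: matrix_vector_mul_assoc)
  then show "cinner v (adj A ** M ** A *v v) \<in> \<real>\<^sub>\<ge>\<^sub>0"
    using assms by (simp add: psd_def)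
qed

lemma psd_ketbra: "psd (ketbra u u)"
  unfolding psd_def
proof
  fix v
  have "ketbra u u *v v = cinner u v *s u"
    by (simp add: vec_eq_iff ketbra_def matrix_vector_mult_def cinner_def sum_distrib_left mult_ac)
  then have "cinner v (ketbra u u *v v) = of_real ((cmod (cinner u v))\<^sup>2)"
    using cinner_commute[of v u] by (simp add: cinner_scale_right of_real_cmod_square)
  then show "cinner v (ketbra u u *v v) \<in> \<real>\<^sub>\<ge>\<^sub>0"
    by (simp only: nonneg_Reals_of_real_iff) simp
qed

subsection \<open>Partial traces\<close>

text \<open>Expanding the form of the marginal over product vectors transfers both positivity and
  null vectors between \<open>\<tau>\<close> and its marginal.\<close>

lemma cinner_partial_trace_B:
  "cinner v (partial_trace_B \<tau> *v v) =
     (\<Sum>b\<in>UNIV. cinner (tensor_vec v (axis b 1)) (\<tau> *v tensor_vec v (axis b 1)))"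
proof -
  have 1: "(\<chi> c. tensor_vec v (axis b 1) $ (j, c)) = v $ j *s axis b 1" for b j
    by (simp add: vec_eq_iff tensor_vec_def)
  have "(\<Sum>b\<in>UNIV. cinner (tensor_vec v (axis b 1)) (\<tau> *v tensor_vec v (axis b 1))) =
      (\<Sum>b\<in>UNIV. \<Sum>j\<in>UNIV. \<Sum>k\<in>UNIV. cnj (v $ j) * \<tau> $ (j, b) $ (k, b) * v $ k)"
    by (simp add: cinner_blocks 1 cinner_scale_left cinner_scale_right vec.scale cinner_axis
        matrix_vector_mult_axis mult_ac)
  also have "\<dots> = (\<Sum>k\<in>UNIV. \<Sum>j\<in>UNIV. \<Sum>b\<in>UNIV. cnj (v $ j) * \<tau> $ (j, b) $ (k, b) * v $ k)"
    by (rule sum_swap_outer_inner)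
  also have "\<dots> = (\<Sum>j\<in>UNIV. \<Sum>k\<in>UNIV. \<Sum>b\<in>UNIV. cnj (v $ j) * \<tau> $ (j, b) $ (k, b) * v $ k)"
    by (rule sum.swap)
  finally show ?thesis
    by (simp add: cinner_def matrix_vector_mult_def partial_trace_B_def sum_distrib_left
        sum_distrib_right mult_ac)
qed

lemma psd_partial_trace_B:
  assumes "psd \<tau>"
  shows "psd (partial_trace_B \<tau>)"
  unfolding psd_def cinner_partial_trace_B
  using assms by (auto intro: sum_nonneg_Reals simp: psd_def)

text \<open>The form of the marginal at \<open>v\<close> is a sum of nonnegative terms over
  \<open>b\<close>; if it vanishes, each term does, and a positive matrix annihilates a vector on
  which its form is zero.\<close>

lemma partial_trace_B_null_vector:
  assumes "psd \<tau>" and "partial_trace_B \<tau> *v v = 0"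
  shows "\<tau> *v tensor_vec v (axis b 1) = 0"
proof (rule psd_null_vector[OF \<open>psd \<tau>\<close>])
  define f where "f b = cinner (tensor_vec v (axis b 1)) (\<tau> *v tensor_vec v (axis b 1))" for b
  have nonneg: "Re (f b) \<ge> 0" "Im (f b) = 0" for b
    using assms(1) by (simp_all add: f_def psd_def complex_nonneg_Reals_iff)
  have "(\<Sum>b\<in>UNIV. f b) = 0"
    using cinner_partial_trace_B[of v \<tau>] assms(2) by (simp add: f_def)
  then have "(\<Sum>b\<in>UNIV. Re (f b)) = 0"
    by (metis Re_sum zero_complex.sel(1))
  then have "Re (f b) = 0"
    using nonneg by (simp add: sum_nonneg_eq_0_iff)
  then show "cinner (tensor_vec v (axis b 1)) (\<tau> *v tensor_vec v (axis b 1)) = 0"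
    using nonneg by (simp add: complex_eq_iff flip: f_def)
qed

text \<open>The support of \<open>\<tau>\<close> lies in the support of its marginal tensored with
  the whole second factor, because \<open>\<tau>\<close> kills every product vector whose first
  factor is in the kernel of the marginal.\<close>

lemma partial_trace_B_support:
  assumes "psd \<tau>"
  defines "P \<equiv> ortho_projector (supp (partial_trace_B \<tau>))"
  shows "tensor_mat P (mat 1) ** \<tau> ** tensor_mat P (mat 1) = \<tau>"
proof -
  note P = psd_support_calculus[OF psd_partial_trace_B[OF \<open>psd \<tau>\<close>], folded P_def]
  have right: "\<tau> ** tensor_mat P (mat 1) = \<tau>"
  proof -
    have "(\<tau> ** tensor_mat P (mat 1)) $ p $ (k, c) = \<tau> $ p $ (k, c)" for p k c
    proof -
      \<comment> \<open>The kernel part of the basis vector \<open>k\<close>: that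
        \<open>\<tau>\<close> kills its tensor product with basis vector \<open>c\<close> is exactly
        the column \<open>(k, c)\<close> of the claim.\<close>
      define v where "v = axis k 1 - P *v axis k 1"
      have "P *v v = 0"
        by (simp add: v_def matrix_vector_mult_diff_distrib matrix_vector_mul_assoc P)
      then have "partial_trace_B \<tau> *v v = 0"
        using P(12) by (auto simp: ker_def)
      then have "\<tau> *v tensor_vec v (axis c 1) = 0"
        by (rule partial_trace_B_null_vector[OF \<open>psd \<tau>\<close>])
      then have "0 = (\<tau> *v tensor_vec v (axis c 1)) $ p"
        by simp
      also have "\<dots> = (\<Sum>m\<in>UNIV. \<tau> $ p $ (m, c) * v $ m)"
        by (simp add: matrix_vector_mult_def tensor_vec_def sum_UNIV_prod axis_def
            if_distrib[of "\<lambda>x. _ * x"] cong: if_cong)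
      also have "\<dots> = (\<Sum>m\<in>UNIV. \<tau> $ p $ (m, c) * axis k 1 $ m) - (\<Sum>m\<in>UNIV. \<tau> $ p $ (m, c) * P $ m $ k)"
        by (simp add: v_def matrix_vector_mult_axis right_diff_distrib sum_subtractf)
      also have "(\<Sum>m\<in>UNIV. \<tau> $ p $ (m, c) * axis k 1 $ m) = \<tau> $ p $ (k, c)"
        by (simp add: axis_def if_distrib[of "\<lambda>x. _ * x"] cong: if_cong)
      finally show ?thesis
        by (simp add: mult_tensor_one_component)
    qed
    then show ?thesis by (simp add: vec_eq_iff)
  qed
  \<comment> \<open>The left identity is the adjoint of the right one, as both factors are
    hermitian.\<close>
  have "tensor_mat P (mat 1) ** \<tau> = \<tau>"
    using arg_cong[OF right, of adj] psd_hermitian[OF \<open>psd \<tau>\<close>]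
    by (simp add: adj_mult adj_tensor_one P)
  then show ?thesis
    by (simp add: right)
qed

subsection \<open>The two constructions\<close>

lemma scale_mat_component: "scale_mat c X $ i $ j = c * X $ i $ j"
  by (simp add: scale_mat_def)

lemma scale_mat_zero [simp]: "scale_mat 0 X = 0"
  by (simp add: vec_eq_iff scale_mat_component)

lemma scale_mat_cancel: "c \<noteq> 0 \<Longrightarrow> scale_mat c X = scale_mat c Y \<longleftrightarrow> X = Y"
  by (simp add: vec_eq_iff scale_mat_component)

lemma scale_mat_sandwich: "A ** scale_mat c X ** B = scale_mat c (A ** X ** B)"
  by (simp add: vec_eq_iff scale_mat_component matrix_matrix_mult_def sum_distrib_left
      sum_distrib_right mult_ac)

lemma add_sandwich: "A ** (X + Y) ** B = A ** X ** B + (A ** Y ** B :: complex ^ 'n ^ 'm)"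
  by (simp add: vec_eq_iff matrix_matrix_mult_def distrib_left distrib_right sum.distrib)

text \<open>Linearity of \<open>E\<close> is known only on \<open>ops_on S\<close>. Precomposed with
  the sandwich, \<open>E\<close> becomes a linear map on all matrices, and such a map is determined
  by its values on matrix units.\<close>

lemma clinear_on_ops_sandwich_eq_choi_map:
  fixes \<tau> :: "complex ^ ('a::finite \<times> 'b::finite) ^ ('a \<times> 'b)"
  assumes lin: "clinear_on_ops S E" and ops: "\<And>X. A ** X ** B \<in> ops_on S"
    and E: "\<And>j k. E (A ** matrix_unit j k ** B) = block \<tau> j k"
  shows "E (A ** X ** B) = choi_map \<tau> X"
proof -
  define F where "F X = E (A ** X ** B)" for X
  have add: "F (X + Y) = F X + F Y" for X Y
    using lin ops by (simp add: F_def clinear_on_ops_def add_sandwich)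
  have scale: "F (scale_mat c X) = scale_mat c (F X)" for c X
    using lin ops by (simp add: F_def clinear_on_ops_def scale_mat_sandwich)
  have zero: "F 0 = 0"
    using scale[of 0 0] by simp
  have sum: "F (sum f I) = (\<Sum>i\<in>I. F (f i))" for f and I :: "'a set"
    by (induction I rule: infinite_finite_induct) (simp_all add: add zero)
  have unit: "F (matrix_unit j k) = block \<tau> j k" for j k
    by (simp add: F_def E)
  have "X = (\<Sum>j\<in>UNIV. \<Sum>k\<in>UNIV. scale_mat (X $ j $ k) (matrix_unit j k))"
  proof -
    have "(\<Sum>j\<in>UNIV. \<Sum>k\<in>UNIV. X $ j $ k * matrix_unit j k $ a $ c) = X $ a $ c" for a c
    proof -
      have "(\<Sum>k\<in>UNIV. X $ j $ k * matrix_unit j k $ a $ c) = (if j = a then X $ a $ c else 0)" for j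
        by (cases "j = a") (simp_all add: matrix_unit_component if_distrib[of "\<lambda>x. _ * x"] cong: if_cong)
      then show ?thesis by simp
    qed
    then show ?thesis by (simp add: vec_eq_iff scale_mat_component)
  qed
  then have "F X = F (\<Sum>j\<in>UNIV. \<Sum>k\<in>UNIV. scale_mat (X $ j $ k) (matrix_unit j k))"
    by simp
  also have "\<dots> = (\<Sum>j\<in>UNIV. \<Sum>k\<in>UNIV. scale_mat (X $ j $ k) (block \<tau> j k))"
    by (simp add: sum scale unit)
  also have "\<dots> = choi_map \<tau> X"
    by (simp add: vec_eq_iff scale_mat_component choi_map_component)
  finally show ?thesis
    by (simp add: F_def)
qed

section \<open>Blocks of the entangled reference states\<close>

lemma Phi_plus_component:
  "(Phi_plus :: complex ^ ('a::finite \<times> 'a)) $ (i, a) =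
     (if i = a then complex_of_real (1 / sqrt (real CARD('a))) else 0)"
proof -
  have "axis j 1 $ i * axis j 1 $ a = (if j = i then if i = a then 1 else 0 else (0::complex))" for j
    by (auto simp: axis_def)
  then show ?thesis
    by (simp add: Phi_plus_def tensor_vec_def)
qed

lemma tensor_one_Phi_plus_component:
  "(tensor_mat A (mat 1) *v (Phi_plus :: complex ^ ('a::finite \<times> 'a))) $ (i, a) =
     complex_of_real (1 / sqrt (real CARD('a))) * A $ i $ a"
  by (simp add: matrix_vector_mult_def tensor_mat_def sum_UNIV_prod Phi_plus_component mat_def
      if_distrib[of "\<lambda>x. _ * x"] if_distrib[of "\<lambda>x. x * _"] cong: if_cong)

text \<open>One computation for both reference vectors: \<open>x = 1\<close> with the square root
  gives \<open>Phi\<close>, and \<open>x = 1 / rank\<close> with the support projector gives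
  \<open>Phi_plus_r\<close>. The factor \<open>sqrt CARD('a)\<close> cancels the normalization of
  \<open>Phi_plus\<close>.\<close>

lemma block_ketbra_scaled_Phi_plus:
  fixes A :: "complex ^ 'a::finite ^ 'a"
  assumes "adj A = A" and "x \<ge> 0"
  defines "v \<equiv> complex_of_real (sqrt (real CARD('a) * x)) *s (tensor_mat A (mat 1) *v Phi_plus)"
  shows "block (ketbra v v) j k =
    scale_mat (of_real x) (transpose A ** matrix_unit j k ** transpose A)"
proof -
  have v: "v $ (i, a) = complex_of_real (sqrt x) * A $ i $ a" for i a
    by (simp add: v_def tensor_one_Phi_plus_component real_sqrt_mult)
  have "cnj (A $ k $ c) = A $ c $ k" for c k
    using assms(1) by (metis adj_component)
  moreover have "complex_of_real (sqrt x) * complex_of_real (sqrt x) = of_real x"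
    using \<open>x \<ge> 0\<close> by (simp flip: of_real_mult)
  ultimately show ?thesis
    by (simp add: vec_eq_iff ketbra_def v scale_mat_component matrix_unit_sandwich transpose_def)
qed

lemma block_forward:
  assumes "psd (transpose \<rho>)"
  defines "T \<equiv> transpose (psd_sqrt (transpose \<rho>))"
  shows "block (ketbra (Phi \<rho>) (Phi \<rho>)) j k = T ** matrix_unit j k ** T"
    and "block (forward (\<rho>, E)) j k = E (T ** matrix_unit j k ** T)"
proof -
  show "block (ketbra (Phi \<rho>) (Phi \<rho>)) j k = T ** matrix_unit j k ** T"
    using block_ketbra_scaled_Phi_plus[of "psd_sqrt (transpose \<rho>)" 1 j k] psd_support_calculus(1)[OF assms(1)]
    by (simp add: Phi_def T_def) (simp add: vec_eq_iff scale_mat_component)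
  then show "block (forward (\<rho>, E)) j k = E (T ** matrix_unit j k ** T)"
    by (simp add: forward_def)
qed

text \<open>\<open>sigma\<close> without its factor \<open>1 / rank\<close>; this is the Choi matrix
  of the map that the reverse construction produces.\<close>

definition omega ::
  "complex ^ ('a::finite \<times> 'b::finite) ^ ('a \<times> 'b) \<Rightarrow> complex ^ ('a \<times> 'b) ^ ('a \<times> 'b)" where
  "omega \<tau> = (let R = tensor_mat (psd_sqrt (supp_inverse (partial_trace_B \<tau>))) (mat 1) in R ** \<tau> ** R)"

lemma sigma_eq_omega: "sigma \<tau> = scale_mat (1 / of_nat (rank (partial_trace_B \<tau>))) (omega \<tau>)"
  by (simp add: sigma_def omega_def Let_def)

lemma choi_map_omega:
  "choi_map (omega \<tau>) X =
     choi_map \<tau> (transpose (psd_sqrt (supp_inverse (partial_trace_B \<tau>))) ** X **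
       transpose (psd_sqrt (supp_inverse (partial_trace_B \<tau>))))"
  by (simp add: omega_def Let_def choi_map_sandwich)

lemma psd_omega:
  assumes "psd \<tau>"
  shows "psd (omega \<tau>)"
  using psd_sandwich[OF assms, of "tensor_mat (psd_sqrt (supp_inverse (partial_trace_B \<tau>))) (mat 1)"]
    psd_support_calculus(2)[OF psd_partial_trace_B[OF assms]]
  by (simp add: omega_def Let_def adj_tensor_one)

text \<open>Compared block by block, both sides of the condition carry the same nonzero factor
  \<open>r\<close>. After cancellation it prescribes \<open>E\<close> on the compressed matrix units
  \<open>Q ** matrix_unit j k ** Q\<close>, which span the operators on the support.\<close>

lemma reverse_condition_iff:
  fixes \<tau> :: "complex ^ ('a::finite \<times> 'b::finite) ^ ('a \<times> 'b)"
  assumes \<tau>: "\<tau> \<in> density_ops" and E: "E \<in> tpcp_maps (supp (reverse_rho \<tau>))"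
  shows "reverse_condition \<tau> E \<longleftrightarrow> (\<forall>X\<in>ops_on (supp (reverse_rho \<tau>)). E X = choi_map (omega \<tau>) X)"
proof -
  define M where "M = partial_trace_B \<tau>"
  define P where "P = ortho_projector (supp M)"
  define Q where "Q = transpose P"
  define r where "r = complex_of_real (1 / real (rank M))"
  have "psd M" "trace M = 1"
    using \<tau> by (simp_all add: M_def density_ops_def psd_partial_trace_B trace_partial_trace_B)
  note M = psd_support_calculus[OF \<open>psd M\<close>, folded P_def, folded Q_def]
  have "r \<noteq> 0"
    using rank_neq_0[of M] \<open>trace M = 1\<close> by (simp add: r_def)
  have ops: "ops_on (supp (reverse_rho \<tau>)) = {X. Q ** X ** Q = X}"
    using M by (simp add: reverse_rho_def M_def)
  have QQ: "Q ** Q = Q"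
    using M by (simp add: Q_def flip: matrix_transpose_mul)
  have sandwich_ops: "Q ** X ** Q \<in> ops_on (supp (reverse_rho \<tau>))" for X
  proof -
    have "Q ** (Q ** X ** Q) ** Q = (Q ** Q) ** X ** (Q ** Q)"
      by (simp add: matrix_mul_assoc)
    then show ?thesis by (simp add: ops QQ)
  qed
  have lin: "clinear_on_ops (supp (reverse_rho \<tau>)) E"
    using E by (simp add: tpcp_maps_def)
  have "block (id_tensor E (ketbra (Phi_plus_r M) (Phi_plus_r M))) j k =
      scale_mat r (E (Q ** matrix_unit j k ** Q))" for j k
  proof -
    have "block (ketbra (Phi_plus_r M) (Phi_plus_r M)) j k = scale_mat r (Q ** matrix_unit j k ** Q)"
      using block_ketbra_scaled_Phi_plus[of P "1 / real (rank M)" j k] M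
      by (simp add: Phi_plus_r_def r_def Q_def flip: P_def)
    then show ?thesis
      using lin sandwich_ops by (simp add: clinear_on_ops_def)
  qed
  moreover have "block (sigma \<tau>) j k = scale_mat r (block (omega \<tau>) j k)" for j k
    by (simp add: sigma_eq_omega r_def vec_eq_iff scale_mat_component flip: M_def)
  moreover have "X = Y \<longleftrightarrow> (\<forall>j k. block X j k = block Y j k)"
    for X Y :: "complex ^ ('a \<times> 'b) ^ ('a \<times> 'b)"
    using block_eqI by blast
  ultimately have "reverse_condition \<tau> E \<longleftrightarrow>
      (\<forall>j k. E (Q ** matrix_unit j k ** Q) = block (omega \<tau>) j k)"
    using E \<open>r \<noteq> 0\<close> unfolding reverse_condition_def M_def[symmetric]
    by (simp only: scale_mat_cancel simp_thms)
  also have "\<dots> \<longleftrightarrow> (\<forall>X\<in>ops_on (supp (reverse_rho \<tau>)). E X = choi_map (omega \<tau>) X)"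
  proof
    assume "\<forall>j k. E (Q ** matrix_unit j k ** Q) = block (omega \<tau>) j k"
    then have "E (Q ** X ** Q) = choi_map (omega \<tau>) X" for X
      by (intro clinear_on_ops_sandwich_eq_choi_map[OF lin sandwich_ops]) blast
    note * = this
    show "\<forall>X\<in>ops_on (supp (reverse_rho \<tau>)). E X = choi_map (omega \<tau>) X"
    proof
      fix X assume "X \<in> ops_on (supp (reverse_rho \<tau>))"
      then have "Q ** X ** Q = X" by (simp add: ops)
      then show "E X = choi_map (omega \<tau>) X" using *[of X] by simp
    qed
  next
    assume *: "\<forall>X\<in>ops_on (supp (reverse_rho \<tau>)). E X = choi_map (omega \<tau>) X"
    define w where "w = transpose (psd_sqrt (supp_inverse M))"
    have w: "w ** Q = w" "Q ** w = w"
      using M by (simp_all add: w_def Q_def flip: matrix_transpose_mul)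
    \<comment> \<open>The inverse root absorbs \<open>Q\<close> on both sides, so
      \<open>choi_map (omega \<tau>)\<close> takes the same value on \<open>X\<close> and on its
      compression.\<close>
    have "w ** (Q ** X ** Q) ** w = (w ** Q) ** X ** (Q ** w)" for X
      by (simp add: matrix_mul_assoc)
    then have "choi_map (omega \<tau>) (Q ** X ** Q) = choi_map (omega \<tau>) X" for X
      by (simp only: choi_map_omega w flip: M_def w_def)
    then show "\<forall>j k. E (Q ** matrix_unit j k ** Q) = block (omega \<tau>) j k"
      using * sandwich_ops by (simp add: choi_map_matrix_unit)
  qed
  finally show ?thesis .
qed

text \<open>Complete positivity comes from \<open>omega \<tau>\<close> being positive; trace
  preservation comes from its marginal being the support projector, that is, from
  \<open>w ** M ** w = P\<close>.\<close>

lemma choi_map_omega_tpcp: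
  assumes \<tau>: "\<tau> \<in> density_ops"
  defines "S \<equiv> supp (reverse_rho \<tau>)"
  shows "restrict (choi_map (omega \<tau>)) (ops_on S) \<in> tpcp_maps S"
proof -
  define M where "M = partial_trace_B \<tau>"
  define s where "s = psd_sqrt M"
  define w where "w = psd_sqrt (supp_inverse M)"
  define P where "P = ortho_projector (supp M)"
  define V where "V = transpose w"
  define Q where "Q = transpose P"
  have psd: "psd \<tau>" "psd M"
    using \<tau> by (simp_all add: M_def density_ops_def psd_partial_trace_B)
  note M = psd_support_calculus[OF \<open>psd M\<close>, folded P_def s_def w_def, folded Q_def]
  have ops: "ops_on S = {X. Q ** X ** Q = X}"
    using M by (simp add: S_def reverse_rho_def M_def)
  have add_ops: "X + Y \<in> ops_on S" if "X \<in> ops_on S" "Y \<in> ops_on S" for X Y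
    using that by (simp add: ops add_sandwich)
  have scale_ops: "scale_mat c X \<in> ops_on S" if "X \<in> ops_on S" for c X
    using that by (simp add: ops scale_mat_sandwich)
  have "completely_positive_on S (restrict (choi_map (omega \<tau>)) (ops_on S))"
    using completely_positive_choi_map[OF psd_omega[OF psd(1)], of S]
    by (simp add: completely_positive_on_def block_psd_def)
  moreover have "trace (choi_map (omega \<tau>) X) = trace X" if "X \<in> ops_on S" for X
  proof -
    have X: "Q ** X ** Q = X" using that by (simp add: ops)
    have "w ** (s ** s) ** w = (w ** s) ** (s ** w)"
      by (simp add: matrix_mul_assoc)
    then have wMw: "w ** M ** w = P"
      using M by simp
    have "V ** transpose M ** V = transpose (w ** M ** w)"
      by (simp add: V_def matrix_transpose_mul matrix_mul_assoc)
    then have VMV: "V ** transpose M ** V = Q"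
      by (simp add: wMw Q_def)
    have "trace (choi_map (omega \<tau>) X) = trace (V ** (X ** V ** transpose M))"
      unfolding choi_map_omega trace_choi_map by (simp add: V_def w_def M_def matrix_mul_assoc)
    also have "\<dots> = trace (X ** (V ** transpose M ** V))"
      by (subst trace_mul_sym) (simp add: matrix_mul_assoc)
    \<comment> \<open>Writing \<open>Q\<close> as \<open>Q ** Q\<close> lets cyclicity of the trace
      move one copy to the left and form \<open>Q ** X ** Q\<close>.\<close>
    also have "\<dots> = trace (X ** (Q ** Q))"
      using M by (simp add: VMV Q_def flip: matrix_transpose_mul)
    also have "\<dots> = trace (Q ** X ** Q)"
      by (metis matrix_mul_assoc trace_mul_sym)
    finally show ?thesis by (simp add: X)
  qed
  ultimately show ?thesis
    using add_ops scale_ops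
    by (simp add: tpcp_maps_def clinear_on_ops_def trace_preserving_on_def choi_map_add choi_map_scale)
qed

text \<open>The condition fixes the values on the domain; maps in \<open>tpcp_maps\<close> are
  extensional, so agreement there is equality of functions.\<close>

lemma ex1_reverse_condition:
  assumes \<tau>: "\<tau> \<in> density_ops"
  shows "\<exists>!E. reverse_condition \<tau> E"
    and "(THE E. reverse_condition \<tau> E) =
      restrict (choi_map (omega \<tau>)) (ops_on (supp (reverse_rho \<tau>)))"
proof -
  have 1: "reverse_condition \<tau> (restrict (choi_map (omega \<tau>)) (ops_on (supp (reverse_rho \<tau>))))"
    using reverse_condition_iff[OF \<tau> choi_map_omega_tpcp[OF \<tau>]] by simp
  have 2: "E = restrict (choi_map (omega \<tau>)) (ops_on (supp (reverse_rho \<tau>)))"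
    if "reverse_condition \<tau> E" for E
  proof -
    have E: "E \<in> tpcp_maps (supp (reverse_rho \<tau>))"
      using that by (simp add: reverse_condition_def)
    then show ?thesis
      using reverse_condition_iff[OF \<tau> E] that
      by (intro extensionalityI[of _ "ops_on (supp (reverse_rho \<tau>))"]) (auto simp: tpcp_maps_def)
  qed
  show "\<exists>!E. reverse_condition \<tau> E"
    using 1 2 by metis
  show "(THE E. reverse_condition \<tau> E) =
      restrict (choi_map (omega \<tau>)) (ops_on (supp (reverse_rho \<tau>)))"
    using 1 2 by (rule the_equality)
qed

section \<open>The two composites\<close>

lemma reverse_eq:
  assumes "\<tau> \<in> density_ops"
  shows "reverse \<tau> =
    (reverse_rho \<tau>, restrict (choi_map (omega \<tau>)) (ops_on (supp (reverse_rho \<tau>))))"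
  using ex1_reverse_condition(2)[OF assms] by (simp add: reverse_def)

lemma reverse_in_state_map_pairs:
  assumes "\<tau> \<in> density_ops"
  shows "reverse \<tau> \<in> state_map_pairs"
proof -
  have "partial_trace_B \<tau> \<in> density_ops"
    using assms by (simp add: density_ops_def psd_partial_trace_B trace_partial_trace_B)
  then have "reverse_rho \<tau> \<in> density_ops"
    by (simp add: reverse_rho_def density_ops_transpose)
  then show ?thesis
    using choi_map_omega_tpcp[OF assms] by (simp add: reverse_eq[OF assms] state_map_pairs_def)
qed

text \<open>The forward construction feeds \<open>T ** matrix_unit j k ** T\<close> to the reverse
  map, which strips \<open>T\<close> off again with \<open>V\<close> up to the projector
  \<open>Q\<close>.\<close>

lemma forward_reverse:
  fixes \<tau> :: "complex ^ ('a::finite \<times> 'b::finite) ^ ('a \<times> 'b)"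
  assumes \<tau>: "\<tau> \<in> density_ops"
  shows "forward (reverse \<tau>) = \<tau>"
proof (rule block_eqI)
  fix j k :: 'a
  define M where "M = partial_trace_B \<tau>"
  define s where "s = psd_sqrt M"
  define w where "w = psd_sqrt (supp_inverse M)"
  define P where "P = ortho_projector (supp M)"
  define T where "T = transpose s"
  define V where "V = transpose w"
  define Q where "Q = transpose P"
  have psd: "psd \<tau>" "psd M"
    using \<tau> by (simp_all add: M_def density_ops_def psd_partial_trace_B)
  note M = psd_support_calculus[OF \<open>psd M\<close>, folded P_def s_def w_def, folded Q_def]
  have ops: "ops_on (supp (reverse_rho \<tau>)) = {X. Q ** X ** Q = X}"
    using M by (simp add: reverse_rho_def M_def)
  have rho: "transpose (reverse_rho \<tau>) = M"
    by (simp add: reverse_rho_def M_def)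
  have VT: "V ** T = Q" "T ** V = Q" "Q ** T = T" "T ** Q = T"
    using M by (simp_all add: V_def T_def Q_def flip: matrix_transpose_mul)
  let ?U = "matrix_unit j k"
  have "Q ** (T ** ?U ** T) ** Q = (Q ** T) ** ?U ** (T ** Q)"
    by (simp add: matrix_mul_assoc)
  then have TUT: "T ** ?U ** T \<in> ops_on (supp (reverse_rho \<tau>))"
    by (simp add: ops VT)
  have "block (forward (reverse \<tau>)) j k =
      restrict (choi_map (omega \<tau>)) (ops_on (supp (reverse_rho \<tau>))) (T ** ?U ** T)"
    unfolding reverse_eq[OF \<tau>] T_def s_def rho[symmetric]
    by (rule block_forward) (simp only: rho psd)
  also have "\<dots> = choi_map (omega \<tau>) (T ** ?U ** T)"
    using TUT by simp
  also have "\<dots> = choi_map \<tau> (V ** (T ** ?U ** T) ** V)"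
    by (simp add: choi_map_omega V_def w_def M_def)
  also have "V ** (T ** ?U ** T) ** V = (V ** T) ** ?U ** (T ** V)"
    by (simp add: matrix_mul_assoc)
  also have "\<dots> = Q ** ?U ** Q"
    by (simp add: VT)
  \<comment> \<open>The projectors move from the argument back onto \<open>\<tau>\<close>, which
    absorbs them since it lives on the support of its marginal.\<close>
  also have "choi_map \<tau> \<dots> = choi_map (tensor_mat P (mat 1) ** \<tau> ** tensor_mat P (mat 1)) ?U"
    by (simp add: choi_map_sandwich Q_def)
  also have "\<dots> = block \<tau> j k"
    using partial_trace_B_support[OF psd(1)] by (simp add: P_def M_def choi_map_matrix_unit)
  finally show "block (forward (reverse \<tau>)) j k = block \<tau> j k" .
qed

text \<open>Every block of \<open>\<tau>\<close> is \<open>E\<close> applied to a sandwiched matrix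
  unit, so \<open>E (T ** X ** T) = choi_map \<tau> X\<close>. Trace preservation recovers
  \<open>\<rho>\<close> from the marginal, and inverting \<open>T\<close> on the support recovers
  \<open>E\<close>.\<close>

lemma forward_density_and_reverse:
  assumes "p \<in> state_map_pairs"
  shows "forward p \<in> density_ops" and "reverse (forward p) = p"
proof -
  obtain \<rho> E where p: "p = (\<rho>, E)" and \<rho>: "\<rho> \<in> density_ops" and E: "E \<in> tpcp_maps (supp \<rho>)"
    using assms by (auto simp: state_map_pairs_def)
  define M where "M = transpose \<rho>"
  define s where "s = psd_sqrt M"
  define w where "w = psd_sqrt (supp_inverse M)"
  define P where "P = ortho_projector (supp M)"
  define T where "T = transpose s"
  define V where "V = transpose w"
  define Q where "Q = transpose P"
  define \<tau> where "\<tau> = forward p"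
  have "psd M" and tr: "trace M = 1"
    using \<rho> by (simp_all add: M_def density_ops_def psd_transpose)
  note M = psd_support_calculus[OF \<open>psd M\<close>, folded P_def s_def w_def, folded Q_def]
  have \<rho>_M: "\<rho> = transpose M"
    by (simp add: M_def)
  have ops: "ops_on (supp \<rho>) = {X. Q ** X ** Q = X}"
    using M by (simp add: \<rho>_M)
  have VT: "V ** T = Q" "T ** V = Q" "Q ** T = T" "T ** Q = T" "T ** T = \<rho>"
    using M by (simp_all add: V_def T_def Q_def \<rho>_M flip: matrix_transpose_mul)
  have lin: "clinear_on_ops (supp \<rho>) E" and cp: "completely_positive_on (supp \<rho>) E"
    and tp: "\<And>X. X \<in> ops_on (supp \<rho>) \<Longrightarrow> trace (E X) = trace X"
    using E by (auto simp: tpcp_maps_def trace_preserving_on_def)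
  have TXT: "T ** X ** T \<in> ops_on (supp \<rho>)" for X
  proof -
    have "Q ** (T ** X ** T) ** Q = (Q ** T) ** X ** (T ** Q)"
      by (simp add: matrix_mul_assoc)
    then show ?thesis by (simp add: ops VT)
  qed
  have block_Phi: "block (ketbra (Phi \<rho>) (Phi \<rho>)) j k = T ** matrix_unit j k ** T"
    and block_\<tau>: "block \<tau> j k = E (T ** matrix_unit j k ** T)" for j k
    unfolding T_def s_def \<tau>_def p M_def
    by (rule block_forward, use \<open>psd M\<close> in \<open>simp only: M_def\<close>)+
  have E_choi: "E (T ** X ** T) = choi_map \<tau> X" for X
    by (rule clinear_on_ops_sandwich_eq_choi_map[OF lin TXT block_\<tau>[symmetric]])
  have "psd \<tau>"
    unfolding \<tau>_def p forward_def
    by (simp add: psd_id_tensor[OF cp psd_ketbra] block_Phi TXT)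
  have ptr: "partial_trace_B \<tau> = M"
  proof -
    have "partial_trace_B \<tau> $ j $ k = trace (block \<tau> j k)" for j k
      by (simp add: partial_trace_B_def trace_def)
    also have "trace (block \<tau> j k) = trace (T ** matrix_unit j k ** T)" for j k
      by (simp add: block_\<tau> tp TXT)
    \<comment> \<open>The indices come out swapped: \<open>T ** T = \<rho>\<close>, and its entry at
      \<open>k\<close>, \<open>j\<close> is the entry of \<open>M\<close> at \<open>j\<close>,
      \<open>k\<close>.\<close>
    also have "trace (T ** matrix_unit j k ** T) = (T ** T) $ k $ j" for j k
      unfolding trace_def matrix_unit_sandwich by (simp add: matrix_matrix_mult_def mult.commute)
    finally show ?thesis
      by (simp add: VT vec_eq_iff M_def transpose_def)
  qed
  show "forward p \<in> density_ops"
    using \<open>psd \<tau>\<close> trace_partial_trace_B[of \<tau>] ptr tr by (simp add: density_ops_def flip: \<tau>_def)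
  then have \<tau>: "\<tau> \<in> density_ops"
    by (simp add: \<tau>_def)
  have rho: "reverse_rho \<tau> = \<rho>"
    by (simp add: reverse_rho_def ptr \<rho>_M)
  have "E X = choi_map (omega \<tau>) X" if "X \<in> ops_on (supp \<rho>)" for X
  proof -
    \<comment> \<open>The sandwich by \<open>V\<close> comes from \<open>omega\<close>, the one by
      \<open>T\<close> from \<open>E_choi\<close>; together they compress \<open>X\<close> by
      \<open>Q\<close>, which fixes operators on the support.\<close>
    have "choi_map (omega \<tau>) X = E (T ** (V ** X ** V) ** T)"
      by (simp only: E_choi choi_map_omega ptr V_def w_def)
    also have "T ** (V ** X ** V) ** T = (T ** V) ** X ** (V ** T)"
      by (simp add: matrix_mul_assoc)
    finally show ?thesis
      using that by (simp add: VT ops)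
  qed
  then have "reverse_condition \<tau> E"
    using reverse_condition_iff[OF \<tau>, of E] E by (simp add: rho)
  then have "(THE E. reverse_condition \<tau> E) = E"
    using ex1_reverse_condition(1)[OF \<tau>] by (rule the1_equality[rotated])
  then have "reverse \<tau> = p"
    by (simp add: reverse_def rho p)
  then show "reverse (forward p) = p"
    by (simp only: \<tau>_def)
qed

theorem mainTheorem1:
  shows "(\<forall>\<tau>\<in>(density_ops :: (complex ^ ('a::finite \<times> 'b::finite) ^ ('a \<times> 'b)) set).
           \<exists>!E. reverse_condition \<tau> E)
         \<and> (\<forall>p\<in>(state_map_pairs :: ((complex ^ 'a ^ 'a) \<times> (complex ^ 'a ^ 'a \<Rightarrow> complex ^ 'b ^ 'b)) set).
           forward p \<in> density_ops \<and> reverse (forward p) = p)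
         \<and> (\<forall>\<tau>\<in>(density_ops :: (complex ^ ('a \<times> 'b) ^ ('a \<times> 'b)) set).
           reverse \<tau> \<in> state_map_pairs \<and> forward (reverse \<tau>) = \<tau>)
         \<and> bij_betw forward
           (state_map_pairs :: ((complex ^ 'a ^ 'a) \<times> (complex ^ 'a ^ 'a \<Rightarrow> complex ^ 'b ^ 'b)) set)
           density_ops"
proof (intro conjI ballI)
  show "bij_betw forward
           (state_map_pairs :: ((complex ^ 'a ^ 'a) \<times> (complex ^ 'a ^ 'a \<Rightarrow> complex ^ 'b ^ 'b)) set)
           density_ops"
    by (rule bij_betw_byWitness[where f' = reverse])
      (auto simp: forward_density_and_reverse forward_reverse reverse_in_state_map_pairs)
qed (simp_all add: ex1_reverse_condition forward_density_and_reverse forward_reverse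
    reverse_in_state_map_pairs)

end
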